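(* Let $\mathbf{Q}$ be a subquantale of a quantale $\mathbf{R}$ and let $\mathbf{M}$ be a left $\mathbf{Q}$-module. If $\mathbf{M}$ is a projective cyclic $\mathbf{Q}$-module, then $\mathbf{R}\otimes_{\mathbf{Q}}\mathbf{M}$ is a projective cyclic $\mathbf{R}$-module. Consequently, if $\mathbf{M}$ is the coproduct of projective cyclic $\mathbf{Q}$-modules, then $\mathbf{R}\otimes_{\mathbf{Q}}\mathbf{M}$ is the coproduct of projective cyclic $\mathbf{R}$-modules as well, and thus is itself projective.
   Context: A quantale $\mathbf{Q}=\langle Q,\vee,\cdot,\bot,e\rangle$ is a sup-lattice (poset with arbitrary joins) with a monoid structure whose product distributes over arbitrary joins in both arguments; a subquantale is closed under arbitrary joins and products and contains $e$. A left $\mathbf{Q}$-module is a sup-lattice $\mathbf{M}$ with $\star:Q\times M\to M$ preserving arbitrary joins in each argument, with $(q_1q_2)\star m=q_1\star(q_2\star m)$ and $e\star m=m$; right modules are analogous. Homomorphisms preserve arbitrary joins and scalars. $\mathbf{M}$ is cyclic if it is generated by a single element $v$, i.e. $M=\{q\star v\mid q\in Q\}$. $\mathbf{M}$ is projective if homomorphisms out of $\mathbf{M}$ lift along surjective homomorphisms. For a right $\mathbf{Q}$-module $\mathbf{M}_1$ and left $\mathbf{Q}$-module $\mathbf{M}_2$, $\mathbf{M}_1\otimes_{\mathbf{Q}}\mathbf{M}_2$ is the sup-lattice with a universal map $(x,y)\mapsto x\otimes y$ among maps $M_1\times M_2\to L$ into sup-lattices preserving arbitrary joins in each variable and satisfying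 $f(x\star q,y)=f(x,q\star y)$. Here $\mathbf{R}$ is regarded as a left $\mathbf{R}$-module and right $\mathbf{Q}$-module by multiplication, and $\mathbf{R}\otimes_{\mathbf{Q}}\mathbf{M}$ is a left $\mathbf{R}$-module via $r\cdot\bigvee_i(r_i\otimes m_i)=\bigvee_i(rr_i)\otimes m_i$. *)

theory Defs
  imports "HOL-Algebra.Complete_Lattice"
begin

section \<open>Sup-lattices\<close>

locale sup_lattice = partial_order L for L (structure) +
  assumes lub_exists: "A \<subseteq> carrier L \<Longrightarrow> \<exists>s. is_lub L s A"
begin

lemma Sup_lub: "A \<subseteq> carrier L \<Longrightarrow> is_lub L (\<Squnion>A) A"
  unfolding sup_def by (rule someI_ex) (rule lub_exists)

lemma Sup_closed [intro, simp]: "A \<subseteq> carrier L \<Longrightarrow> \<Squnion>A \<in> carrier L"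
  by (drule Sup_lub) (simp add: least_def Upper_def)

lemma Sup_upper: "A \<subseteq> carrier L \<Longrightarrow> a \<in> A \<Longrightarrow> a \<sqsubseteq> \<Squnion>A"
  using Sup_lub[of A] by (auto simp: least_def Upper_def)

lemma Sup_least:
  "A \<subseteq> carrier L \<Longrightarrow> x \<in> carrier L \<Longrightarrow> (\<And>a. a \<in> A \<Longrightarrow> a \<sqsubseteq> x) \<Longrightarrow> \<Squnion>A \<sqsubseteq> x"
  using Sup_lub[of A] by (auto simp: least_def Upper_def)

lemma Sup_le_iff:
  assumes A: "A \<subseteq> carrier L" and x: "x \<in> carrier L"
  shows "\<Squnion>A \<sqsubseteq> x \<longleftrightarrow> (\<forall>a\<in>A. a \<sqsubseteq> x)"
proof
  assume le: "\<Squnion>A \<sqsubseteq> x"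
  show "\<forall>a\<in>A. a \<sqsubseteq> x"
  proof
    fix a assume a: "a \<in> A"
    show "a \<sqsubseteq> x"
      by (rule le_trans[OF Sup_upper[OF A a] le]) (use A a x in auto)
  qed
next
  assume "\<forall>a\<in>A. a \<sqsubseteq> x"
  then show "\<Squnion>A \<sqsubseteq> x"
    by (intro Sup_least[OF A x]) blast
qed

lemma antisym:
  assumes "x \<sqsubseteq> y" "y \<sqsubseteq> x" "x \<in> carrier L" "y \<in> carrier L"
  shows "x = y"
  by (rule weak_le_antisym[OF assms, unfolded eq_is_equal])

lemma eq_by_upper_bounds:
  assumes x: "x \<in> carrier L" and y: "y \<in> carrier L"
    and eq: "\<And>z. z \<in> carrier L \<Longrightarrow> x \<sqsubseteq> z \<longleftrightarrow> y \<sqsubseteq> z"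
  shows "x = y"
  by (rule antisym[OF _ _ x y]) (simp_all add: eq[OF y] eq[OF x, symmetric] x y)

lemma Sup_eqI:
  assumes A: "A \<subseteq> carrier L" and s: "s \<in> carrier L"
    and eq: "\<And>z. z \<in> carrier L \<Longrightarrow> s \<sqsubseteq> z \<longleftrightarrow> (\<forall>a\<in>A. a \<sqsubseteq> z)"
  shows "\<Squnion>A = s"
  by (rule eq_by_upper_bounds[OF Sup_closed[OF A] s]) (simp add: Sup_le_iff[OF A] eq)

lemma Sup_singleton [simp]: "x \<in> carrier L \<Longrightarrow> \<Squnion>{x} = x"
  by (rule Sup_eqI) auto

lemma Sup_pair:
  assumes "x \<in> carrier L" "y \<in> carrier L" "x \<sqsubseteq> y"
  shows "\<Squnion>{x, y} = y"
proof (rule Sup_eqI)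
  fix z assume "z \<in> carrier L"
  then show "y \<sqsubseteq> z \<longleftrightarrow> (\<forall>a\<in>{x, y}. a \<sqsubseteq> z)"
    using le_trans[OF assms(3), of z] assms by blast
qed (use assms in auto)

end

lemma sup_latticeI:
  assumes "\<And>x y. x .=\<^bsub>L\<^esub> y \<longleftrightarrow> x = y"
    and "\<And>x. x \<in> carrier L \<Longrightarrow> x \<sqsubseteq>\<^bsub>L\<^esub> x"
    and "\<And>x y. x \<in> carrier L \<Longrightarrow> y \<in> carrier L \<Longrightarrow> x \<sqsubseteq>\<^bsub>L\<^esub> y \<Longrightarrow> y \<sqsubseteq>\<^bsub>L\<^esub> x \<Longrightarrow> x = y"
    and "\<And>x y z. x \<in> carrier L \<Longrightarrow> y \<in> carrier L \<Longrightarrow> z \<in> carrier L \<Longrightarrow>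
           x \<sqsubseteq>\<^bsub>L\<^esub> y \<Longrightarrow> y \<sqsubseteq>\<^bsub>L\<^esub> z \<Longrightarrow> x \<sqsubseteq>\<^bsub>L\<^esub> z"
    and "\<And>A. A \<subseteq> carrier L \<Longrightarrow>
           \<exists>s\<in>carrier L. \<forall>z\<in>carrier L. s \<sqsubseteq>\<^bsub>L\<^esub> z \<longleftrightarrow> (\<forall>a\<in>A. a \<sqsubseteq>\<^bsub>L\<^esub> z)"
  shows "sup_lattice L"
proof -
  have eq: "eq L = (=)"
    by (intro ext) (rule assms(1))
  interpret partial_order L
  proof
    fix x y z w assume c: "x \<in> carrier L" "y \<in> carrier L" "z \<in> carrier L"
    show "x \<sqsubseteq>\<^bsub>L\<^esub> y \<Longrightarrow> y \<sqsubseteq>\<^bsub>L\<^esub> z \<Longrightarrow> x \<sqsubseteq>\<^bsub>L\<^esub> z"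
      by (rule assms(4)[OF c])
  next
    fix x y assume "x \<sqsubseteq>\<^bsub>L\<^esub> y" "y \<sqsubseteq>\<^bsub>L\<^esub> x" "x \<in> carrier L" "y \<in> carrier L"
    then show "x .=\<^bsub>L\<^esub> y"
      using assms(3) eq by simp
  qed (simp_all add: eq assms(2))
  show ?thesis
  proof
    fix A assume A: "A \<subseteq> carrier L"
    obtain s where s: "s \<in> carrier L"
      and *: "\<And>z. z \<in> carrier L \<Longrightarrow> s \<sqsubseteq>\<^bsub>L\<^esub> z \<longleftrightarrow> (\<forall>a\<in>A. a \<sqsubseteq>\<^bsub>L\<^esub> z)"
      using assms(5)[OF A] by blast
    have "\<forall>a\<in>A. a \<sqsubseteq>\<^bsub>L\<^esub> s"
      using *[OF s] assms(2)[OF s] by simp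
    then have "is_lub L s A"
      using A s * unfolding least_def Upper_def by auto
    then show "\<exists>s. is_lub L s A" by blast
  qed
qed

definition sup_hom :: "('a, 'c) gorder_scheme \<Rightarrow> ('b, 'd) gorder_scheme \<Rightarrow> ('a \<Rightarrow> 'b) set" where
  "sup_hom L K =
     {f \<in> carrier L \<rightarrow> carrier K. \<forall>A \<subseteq> carrier L. f (\<Squnion>\<^bsub>L\<^esub>A) = \<Squnion>\<^bsub>K\<^esub>(f ` A)}"

section \<open>Quantales and their modules\<close>

record 'a quantale = "'a gorder" +
  qmult :: "'a \<Rightarrow> 'a \<Rightarrow> 'a" (infixl \<open>\<cdot>\<index>\<close> 70)
  qone :: 'a

locale quantale = sup_lattice R for R (structure) +
  assumes mult_closed [intro, simp]: "x \<in> carrier R \<Longrightarrow> y \<in> carrier R \<Longrightarrow> x \<cdot> y \<in> carrier R"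
    and one_closed [intro, simp]: "qone R \<in> carrier R"
    and mult_assoc: "x \<in> carrier R \<Longrightarrow> y \<in> carrier R \<Longrightarrow> z \<in> carrier R \<Longrightarrow>
          (x \<cdot> y) \<cdot> z = x \<cdot> (y \<cdot> z)"
    and one_left [simp]: "x \<in> carrier R \<Longrightarrow> qone R \<cdot> x = x"
    and one_right [simp]: "x \<in> carrier R \<Longrightarrow> x \<cdot> qone R = x"
    and mult_Sup_right: "x \<in> carrier R \<Longrightarrow> A \<subseteq> carrier R \<Longrightarrow> x \<cdot> (\<Squnion>A) = \<Squnion>((\<lambda>y. x \<cdot> y) ` A)"
    and mult_Sup_left: "x \<in> carrier R \<Longrightarrow> A \<subseteq> carrier R \<Longrightarrow> (\<Squnion>A) \<cdot> x = \<Squnion>((\<lambda>y. y \<cdot> x) ` A)"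

text \<open>A subquantale is a subset; as a quantale in its own right it is
  \<^term>\<open>R\<lparr>carrier := Q\<rparr>\<close>.\<close>

locale subquantale =
  fixes Q :: "'a set" and R (structure)
  assumes subset: "Q \<subseteq> carrier R"
    and one_mem: "qone R \<in> Q"
    and mult_mem: "x \<in> Q \<Longrightarrow> y \<in> Q \<Longrightarrow> x \<cdot> y \<in> Q"
    and Sup_mem: "A \<subseteq> Q \<Longrightarrow> \<Squnion>A \<in> Q"

text \<open>The same record serves for left and right modules: in a right module
  \<open>act M q x\<close> stands for the product of \<open>x\<close> by \<open>q\<close> on the right.\<close>

record ('q, 'm) qmodule = "'m gorder" +
  act :: "'q \<Rightarrow> 'm \<Rightarrow> 'm" (infixr \<open>\<star>\<index>\<close> 75)

locale left_module = quantale Q + sup_lattice M for Q and M :: "('q, 'm) qmodule" (structure) +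
  assumes act_closed: "q \<in> carrier Q \<Longrightarrow> x \<in> carrier M \<Longrightarrow> q \<star> x \<in> carrier M"
    and act_mult: "p \<in> carrier Q \<Longrightarrow> q \<in> carrier Q \<Longrightarrow> x \<in> carrier M \<Longrightarrow>
          (p \<cdot>\<^bsub>Q\<^esub> q) \<star> x = p \<star> (q \<star> x)"
    and act_one: "x \<in> carrier M \<Longrightarrow> qone Q \<star> x = x"
    and act_Sup_right: "q \<in> carrier Q \<Longrightarrow> A \<subseteq> carrier M \<Longrightarrow>
          q \<star> (\<Squnion>A) = \<Squnion>((\<lambda>x. q \<star> x) ` A)"
    and act_Sup_left: "B \<subseteq> carrier Q \<Longrightarrow> x \<in> carrier M \<Longrightarrow>
          (\<Squnion>\<^bsub>Q\<^esub>B) \<star> x = \<Squnion>((\<lambda>q. q \<star> x) ` B)"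

locale right_module = quantale Q + sup_lattice M for Q and M :: "('q, 'm) qmodule" (structure) +
  assumes act_closed: "q \<in> carrier Q \<Longrightarrow> x \<in> carrier M \<Longrightarrow> q \<star> x \<in> carrier M"
    and act_mult: "p \<in> carrier Q \<Longrightarrow> q \<in> carrier Q \<Longrightarrow> x \<in> carrier M \<Longrightarrow>
          (p \<cdot>\<^bsub>Q\<^esub> q) \<star> x = q \<star> (p \<star> x)"
    and act_one: "x \<in> carrier M \<Longrightarrow> qone Q \<star> x = x"
    and act_Sup_right: "q \<in> carrier Q \<Longrightarrow> A \<subseteq> carrier M \<Longrightarrow>
          q \<star> (\<Squnion>A) = \<Squnion>((\<lambda>x. q \<star> x) ` A)"
    and act_Sup_left: "B \<subseteq> carrier Q \<Longrightarrow> x \<in> carrier M \<Longrightarrow>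
          (\<Squnion>\<^bsub>Q\<^esub>B) \<star> x = \<Squnion>((\<lambda>q. q \<star> x) ` B)"

definition left_regular :: "'r quantale \<Rightarrow> ('r, 'r) qmodule" where
  "left_regular R = \<lparr>carrier = carrier R, eq = eq R, le = le R, act = (\<lambda>q x. q \<cdot>\<^bsub>R\<^esub> x)\<rparr>"

definition right_regular :: "'r quantale \<Rightarrow> ('r, 'r) qmodule" where
  "right_regular R = \<lparr>carrier = carrier R, eq = eq R, le = le R, act = (\<lambda>q x. x \<cdot>\<^bsub>R\<^esub> q)\<rparr>"

definition qmod_hom :: "'q quantale \<Rightarrow> ('q, 'm) qmodule \<Rightarrow> ('q, 'n) qmodule \<Rightarrow> ('m \<Rightarrow> 'n) set" where
  "qmod_hom Q M N =
     {f \<in> sup_hom M N. \<forall>q\<in>carrier Q. \<forall>x\<in>carrier M. f (q \<star>\<^bsub>M\<^esub> x) = q \<star>\<^bsub>N\<^esub> f x}"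

definition cyclic_module :: "'q quantale \<Rightarrow> ('q, 'm) qmodule \<Rightarrow> bool" where
  "cyclic_module Q M \<longleftrightarrow> (\<exists>v\<in>carrier M. carrier M = {q \<star>\<^bsub>M\<^esub> v | q. q \<in> carrier Q})"

section \<open>Projective modules\<close>

text \<open>A formula cannot quantify over types, so the lifting property is first stated for
  modules \<open>N\<close> and \<open>P\<close> whose elements live in given types; \<open>projective\<close> fixes types that are
  large enough, and the theorem \<open>projective_any_type\<close> below shows that lifting then holds for
  modules over arbitrary types.\<close>

definition projective_wrt ::
  "'n itself \<Rightarrow> 'p itself \<Rightarrow> 'q quantale \<Rightarrow> ('q, 'm) qmodule \<Rightarrow> bool" where
  "projective_wrt _ _ Q M \<longleftrightarrow>
     (\<forall>(N :: ('q, 'n) qmodule) (P :: ('q, 'p) qmodule) g f.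
        left_module Q N \<longrightarrow> left_module Q P \<longrightarrow>
        g \<in> qmod_hom Q N P \<longrightarrow> g ` carrier N = carrier P \<longrightarrow> f \<in> qmod_hom Q M P \<longrightarrow>
        (\<exists>h \<in> qmod_hom Q M N. \<forall>x\<in>carrier M. g (h x) = f x))"

definition projective :: "'q quantale \<Rightarrow> ('q, 'm) qmodule \<Rightarrow> bool" where
  "projective Q M \<longleftrightarrow> projective_wrt TYPE('m \<Rightarrow> 'q) TYPE('m) Q M"

section \<open>Coproducts\<close>

text \<open>The same device as for \<open>projective\<close>; see the theorem \<open>coproduct_any_type\<close>.\<close>

definition coproduct_wrt ::
  "'n itself \<Rightarrow> 'q quantale \<Rightarrow> 'i set \<Rightarrow> ('i \<Rightarrow> ('q, 'm) qmodule) \<Rightarrow> ('q, 'c) qmodule \<Rightarrow>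
     ('i \<Rightarrow> 'm \<Rightarrow> 'c) \<Rightarrow> bool" where
  "coproduct_wrt _ Q I M C \<iota> \<longleftrightarrow>
     (\<forall>i\<in>I. left_module Q (M i)) \<and> left_module Q C \<and> (\<forall>i\<in>I. \<iota> i \<in> qmod_hom Q (M i) C) \<and>
     (\<forall>(N :: ('q, 'n) qmodule) f.
        left_module Q N \<longrightarrow> (\<forall>i\<in>I. f i \<in> qmod_hom Q (M i) N) \<longrightarrow>
        (\<exists>h \<in> qmod_hom Q C N. (\<forall>i\<in>I. \<forall>x\<in>carrier (M i). h (\<iota> i x) = f i x) \<and>
           (\<forall>h' \<in> qmod_hom Q C N. (\<forall>i\<in>I. \<forall>x\<in>carrier (M i). h' (\<iota> i x) = f i x) \<longrightarrow>
              (\<forall>c\<in>carrier C. h' c = h c))))"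

definition coproduct ::
  "'q quantale \<Rightarrow> 'i set \<Rightarrow> ('i \<Rightarrow> ('q, 'm) qmodule) \<Rightarrow> ('q, 'c) qmodule \<Rightarrow>
     ('i \<Rightarrow> 'm \<Rightarrow> 'c) \<Rightarrow> bool" where
  "coproduct Q I M C \<iota> \<longleftrightarrow>
     coproduct_wrt TYPE('i \<Rightarrow> 'm) Q I M C \<iota> \<and> coproduct_wrt TYPE('c) Q I M C \<iota>"

section \<open>Tensor products and extension of scalars\<close>

definition balanced_map ::
  "'q quantale \<Rightarrow> ('q, 'a) qmodule \<Rightarrow> ('q, 'b) qmodule \<Rightarrow> ('l, 'z) gorder_scheme \<Rightarrow>
     ('a \<Rightarrow> 'b \<Rightarrow> 'l) set" where
  "balanced_map Q M1 M2 L =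
     {f. (\<forall>y\<in>carrier M2. (\<lambda>x. f x y) \<in> sup_hom M1 L) \<and>
         (\<forall>x\<in>carrier M1. f x \<in> sup_hom M2 L) \<and>
         (\<forall>q\<in>carrier Q. \<forall>x\<in>carrier M1. \<forall>y\<in>carrier M2.
            f (q \<star>\<^bsub>M1\<^esub> x) y = f x (q \<star>\<^bsub>M2\<^esub> y))}"

text \<open>Again the universal property is relative to a type of test objects; see the theorems
  \<open>tensor_product_any_type\<close> and \<open>tensor_product_exists\<close>.\<close>

definition tensor_product_wrt ::
  "'l itself \<Rightarrow> 'q quantale \<Rightarrow> ('q, 'a) qmodule \<Rightarrow> ('q, 'b) qmodule \<Rightarrow> ('t, 'z) gorder_scheme \<Rightarrow>
     ('a \<Rightarrow> 'b \<Rightarrow> 't) \<Rightarrow> bool" where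
  "tensor_product_wrt _ Q M1 M2 T \<tau> \<longleftrightarrow>
     right_module Q M1 \<and> left_module Q M2 \<and> sup_lattice T \<and> \<tau> \<in> balanced_map Q M1 M2 T \<and>
     (\<forall>(L :: 'l gorder) f.
        sup_lattice L \<longrightarrow> f \<in> balanced_map Q M1 M2 L \<longrightarrow>
        (\<exists>h \<in> sup_hom T L. (\<forall>x\<in>carrier M1. \<forall>y\<in>carrier M2. h (\<tau> x y) = f x y) \<and>
           (\<forall>h' \<in> sup_hom T L. (\<forall>x\<in>carrier M1. \<forall>y\<in>carrier M2. h' (\<tau> x y) = f x y) \<longrightarrow>
              (\<forall>t\<in>carrier T. h' t = h t))))"

definition tensor_product ::
  "'q quantale \<Rightarrow> ('q, 'a) qmodule \<Rightarrow> ('q, 'b) qmodule \<Rightarrow> ('t, 'z) gorder_scheme \<Rightarrow>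
     ('a \<Rightarrow> 'b \<Rightarrow> 't) \<Rightarrow> bool" where
  "tensor_product Q M1 M2 T \<tau> \<longleftrightarrow>
     tensor_product_wrt TYPE(('a \<times> 'b) set) Q M1 M2 T \<tau> \<and> tensor_product_wrt TYPE('t) Q M1 M2 T \<tau>"

text \<open>\<open>T\<close> with \<open>\<tau> r m = r \<otimes> m\<close> is the left \<open>R\<close>-module \<open>R \<otimes> M\<close> over \<open>Q\<close>; see
  \<open>scalar_extension_exists\<close>.\<close>

definition scalar_extension ::
  "'r quantale \<Rightarrow> 'r set \<Rightarrow> ('r, 'm) qmodule \<Rightarrow> ('r, 't) qmodule \<Rightarrow> ('r \<Rightarrow> 'm \<Rightarrow> 't) \<Rightarrow> bool" where
  "scalar_extension R Q M T \<tau> \<longleftrightarrow>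
     tensor_product (R\<lparr>carrier := Q\<rparr>) (right_regular R) M T \<tau> \<and>
     left_module R T \<and>
     (\<forall>r\<in>carrier R. \<forall>S \<subseteq> carrier R \<times> carrier M.
        r \<star>\<^bsub>T\<^esub> (\<Squnion>\<^bsub>T\<^esub>{\<tau> s m | s m. (s, m) \<in> S}) = \<Squnion>\<^bsub>T\<^esub>{\<tau> (r \<cdot>\<^bsub>R\<^esub> s) m | s m. (s, m) \<in> S})"

section \<open>Independence of the test types\<close>

lemma Sup_cong:
  assumes "carrier L = carrier K" "le L = le K"
  shows "\<Squnion>\<^bsub>L\<^esub>A = \<Squnion>\<^bsub>K\<^esub>A"
  using assms by (simp add: sup_def least_def Upper_def)

lemma sup_homI:
  assumes "\<And>x. x \<in> carrier L \<Longrightarrow> f x \<in> carrier K"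
    and "\<And>A. A \<subseteq> carrier L \<Longrightarrow> f (\<Squnion>\<^bsub>L\<^esub>A) = \<Squnion>\<^bsub>K\<^esub>(f ` A)"
  shows "f \<in> sup_hom L K"
  using assms by (simp add: sup_hom_def)

lemma sup_hom_closed: "f \<in> sup_hom L K \<Longrightarrow> x \<in> carrier L \<Longrightarrow> f x \<in> carrier K"
  by (auto simp: sup_hom_def)

lemma sup_hom_Sup: "f \<in> sup_hom L K \<Longrightarrow> A \<subseteq> carrier L \<Longrightarrow> f (\<Squnion>\<^bsub>L\<^esub>A) = \<Squnion>\<^bsub>K\<^esub>(f ` A)"
  by (simp add: sup_hom_def)

lemma sup_hom_id: "(\<lambda>x. x) \<in> sup_hom L L"
  by (simp add: sup_hom_def)

lemma sup_hom_comp: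
  assumes f: "f \<in> sup_hom L K" and g: "g \<in> sup_hom K J"
  shows "(\<lambda>x. g (f x)) \<in> sup_hom L J"
proof (rule sup_homI)
  fix A assume A: "A \<subseteq> carrier L"
  have "f ` A \<subseteq> carrier K"
    using A sup_hom_closed[OF f] by auto
  then show "g (f (\<Squnion>\<^bsub>L\<^esub>A)) = \<Squnion>\<^bsub>J\<^esub>((\<lambda>x. g (f x)) ` A)"
    by (simp add: sup_hom_Sup[OF f A] sup_hom_Sup[OF g] image_image)
qed (simp add: sup_hom_closed[OF g] sup_hom_closed[OF f])

lemma qmod_homI:
  assumes "\<And>x. x \<in> carrier M \<Longrightarrow> f x \<in> carrier N"
    and "\<And>A. A \<subseteq> carrier M \<Longrightarrow> f (\<Squnion>\<^bsub>M\<^esub>A) = \<Squnion>\<^bsub>N\<^esub>(f ` A)"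
    and "\<And>q x. q \<in> carrier Q \<Longrightarrow> x \<in> carrier M \<Longrightarrow> f (q \<star>\<^bsub>M\<^esub> x) = q \<star>\<^bsub>N\<^esub> f x"
  shows "f \<in> qmod_hom Q M N"
  using assms by (simp add: qmod_hom_def sup_hom_def)

lemma qmod_hom_sup_hom: "f \<in> qmod_hom Q M N \<Longrightarrow> f \<in> sup_hom M N"
  by (simp add: qmod_hom_def)

lemmas qmod_hom_closed = sup_hom_closed[OF qmod_hom_sup_hom]
lemmas qmod_hom_Sup = sup_hom_Sup[OF qmod_hom_sup_hom]

lemma qmod_hom_act:
  "f \<in> qmod_hom Q M N \<Longrightarrow> q \<in> carrier Q \<Longrightarrow> x \<in> carrier M \<Longrightarrow> f (q \<star>\<^bsub>M\<^esub> x) = q \<star>\<^bsub>N\<^esub> f x"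
  by (simp add: qmod_hom_def)

lemma qmod_hom_id: "(\<lambda>x. x) \<in> qmod_hom Q M M"
  by (simp add: qmod_hom_def sup_hom_id)

lemma qmod_hom_comp:
  assumes "f \<in> qmod_hom Q M N" "g \<in> qmod_hom Q N P"
  shows "(\<lambda>x. g (f x)) \<in> qmod_hom Q M P"
  using sup_hom_comp[OF assms[THEN qmod_hom_sup_hom]] assms qmod_hom_closed[OF assms(1)]
  by (simp add: qmod_hom_def)

lemma coproduct_lift:
  assumes C: "coproduct_wrt TYPE('n) Q I M C \<iota>" and N: "left_module Q (N :: ('q, 'n) qmodule)"
    and f: "\<And>i. i \<in> I \<Longrightarrow> f i \<in> qmod_hom Q (M i) N"
  shows "\<exists>h\<in>qmod_hom Q C N. \<forall>i\<in>I. \<forall>x\<in>carrier (M i). h (\<iota> i x) = f i x"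
proof -
  have "\<exists>h \<in> qmod_hom Q C N. (\<forall>i\<in>I. \<forall>x\<in>carrier (M i). h (\<iota> i x) = f i x) \<and>
           (\<forall>h' \<in> qmod_hom Q C N. (\<forall>i\<in>I. \<forall>x\<in>carrier (M i). h' (\<iota> i x) = f i x) \<longrightarrow>
              (\<forall>c\<in>carrier C. h' c = h c))"
    using C N f unfolding coproduct_wrt_def by simp
  then show ?thesis by blast
qed

lemma coproduct_unique:
  assumes C: "coproduct_wrt TYPE('n) Q I M C \<iota>" and N: "left_module Q (N :: ('q, 'n) qmodule)"
    and h: "h1 \<in> qmod_hom Q C N" "h2 \<in> qmod_hom Q C N"
    and eq: "\<And>i x. i \<in> I \<Longrightarrow> x \<in> carrier (M i) \<Longrightarrow> h1 (\<iota> i x) = h2 (\<iota> i x)"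
    and c: "c \<in> carrier C"
  shows "h1 c = h2 c"
proof -
  have "\<forall>i\<in>I. \<iota> i \<in> qmod_hom Q (M i) C"
    using C unfolding coproduct_wrt_def by simp
  then have f: "\<forall>i\<in>I. (\<lambda>x. h2 (\<iota> i x)) \<in> qmod_hom Q (M i) N"
    by (auto intro: qmod_hom_comp[OF _ h(2)])
  have "\<exists>h \<in> qmod_hom Q C N. (\<forall>i\<in>I. \<forall>x\<in>carrier (M i). h (\<iota> i x) = h2 (\<iota> i x)) \<and>
           (\<forall>h' \<in> qmod_hom Q C N. (\<forall>i\<in>I. \<forall>x\<in>carrier (M i). h' (\<iota> i x) = h2 (\<iota> i x)) \<longrightarrow>
              (\<forall>c\<in>carrier C. h' c = h c))"
    using C N f unfolding coproduct_wrt_def by (elim conjE allE impE) assumption+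
  then obtain h where u: "\<forall>h' \<in> qmod_hom Q C N.
      (\<forall>i\<in>I. \<forall>x\<in>carrier (M i). h' (\<iota> i x) = h2 (\<iota> i x)) \<longrightarrow> (\<forall>c\<in>carrier C. h' c = h c)"
    by blast
  have "h1 c = h c"
    by (rule u[rule_format, OF h(1) _ c]) (rule eq)
  moreover have "h2 c = h c"
    by (rule u[rule_format, OF h(2) _ c]) (rule refl)
  ultimately show ?thesis by simp
qed

subsection \<open>Direct products are coproducts\<close>

definition product_module ::
  "'i set \<Rightarrow> ('i \<Rightarrow> ('q, 'm) qmodule) \<Rightarrow> ('q, 'i \<Rightarrow> 'm) qmodule" where
  "product_module I M =
     \<lparr>carrier = (\<Pi>\<^sub>E i\<in>I. carrier (M i)), eq = (=), le = (\<lambda>f g. \<forall>i\<in>I. f i \<sqsubseteq>\<^bsub>M i\<^esub> g i),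
      act = (\<lambda>q f. \<lambda>i\<in>I. q \<star>\<^bsub>M i\<^esub> f i)\<rparr>"

definition product_injection ::
  "'i set \<Rightarrow> ('i \<Rightarrow> ('q, 'm) qmodule) \<Rightarrow> 'i \<Rightarrow> 'm \<Rightarrow> ('i \<Rightarrow> 'm)" where
  "product_injection I M j x = (\<lambda>i\<in>I. if i = j then x else \<Squnion>\<^bsub>M i\<^esub>{})"

lemma product_module_sel [simp]:
  "carrier (product_module I M) = (\<Pi>\<^sub>E i\<in>I. carrier (M i))"
  "eq (product_module I M) = (=)"
  "le (product_module I M) f g \<longleftrightarrow> (\<forall>i\<in>I. f i \<sqsubseteq>\<^bsub>M i\<^esub> g i)"
  "act (product_module I M) q f = (\<lambda>i\<in>I. q \<star>\<^bsub>M i\<^esub> f i)"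
  by (simp_all add: product_module_def)

locale module_family = quantale Q for Q :: "'q quantale" and I :: "'i set" and M :: "'i \<Rightarrow> ('q, 'm) qmodule" +
  assumes modules: "i \<in> I \<Longrightarrow> left_module Q (M i)"
begin

abbreviation "DP \<equiv> product_module I M"

lemma lattices: "i \<in> I \<Longrightarrow> sup_lattice (M i)"
  using modules left_module.axioms(2) by blast

lemma mem: "p \<in> carrier DP \<Longrightarrow> i \<in> I \<Longrightarrow> p i \<in> carrier (M i)"
  by auto

lemma component:
  "A \<subseteq> carrier DP \<Longrightarrow> i \<in> I \<Longrightarrow> (\<lambda>f. f i) ` A \<subseteq> carrier (M i)"
  by auto

lemma product_Sup_bound:
  assumes A: "A \<subseteq> carrier DP" and z: "z \<in> carrier DP"
  shows "(\<lambda>i\<in>I. \<Squnion>\<^bsub>M i\<^esub>((\<lambda>f. f i) ` A)) \<sqsubseteq>\<^bsub>DP\<^esub> z \<longleftrightarrow> (\<forall>a\<in>A. a \<sqsubseteq>\<^bsub>DP\<^esub> z)"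
proof -
  have "\<Squnion>\<^bsub>M i\<^esub>((\<lambda>f. f i) ` A) \<sqsubseteq>\<^bsub>M i\<^esub> z i \<longleftrightarrow> (\<forall>a\<in>A. a i \<sqsubseteq>\<^bsub>M i\<^esub> z i)" if i: "i \<in> I" for i
  proof -
    have "z i \<in> carrier (M i)"
      using z i by auto
    then show ?thesis
      using sup_lattice.Sup_le_iff[OF lattices[OF i] component[OF A i]] by simp
  qed
  then show ?thesis by auto
qed

lemma product_Sup_mem:
  assumes A: "A \<subseteq> carrier DP"
  shows "(\<lambda>i\<in>I. \<Squnion>\<^bsub>M i\<^esub>((\<lambda>f. f i) ` A)) \<in> carrier DP"
  using sup_lattice.Sup_closed[OF lattices component[OF A]] by simp

lemma product_sup_lattice: "sup_lattice DP"
proof (rule sup_latticeI)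
  fix x assume "x \<in> carrier DP"
  then show "x \<sqsubseteq>\<^bsub>DP\<^esub> x"
    using weak_partial_order.le_refl[OF partial_order.axioms(1)[OF sup_lattice.axioms(1)[OF lattices]]]
    by auto
next
  fix x y assume xy: "x \<in> carrier DP" "y \<in> carrier DP" "x \<sqsubseteq>\<^bsub>DP\<^esub> y" "y \<sqsubseteq>\<^bsub>DP\<^esub> x"
  have "x i = y i" if "i \<in> I" for i
    using sup_lattice.antisym[OF lattices[OF that], of "x i" "y i"] xy that by auto
  then show "x = y"
    using xy(1,2) by (auto intro: PiE_ext)
next
  fix x y z assume xyz: "x \<in> carrier DP" "y \<in> carrier DP" "z \<in> carrier DP" "x \<sqsubseteq>\<^bsub>DP\<^esub> y" "y \<sqsubseteq>\<^bsub>DP\<^esub> z"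
  have "x i \<sqsubseteq>\<^bsub>M i\<^esub> z i" if "i \<in> I" for i
  proof -
    interpret sup_lattice "M i" by (rule lattices[OF that])
    show ?thesis
      by (rule le_trans[of "x i" "y i"]) (use xyz that in auto)
  qed
  then show "x \<sqsubseteq>\<^bsub>DP\<^esub> z" by simp
next
  fix A assume A: "A \<subseteq> carrier DP"
  show "\<exists>s\<in>carrier DP. \<forall>z\<in>carrier DP. s \<sqsubseteq>\<^bsub>DP\<^esub> z \<longleftrightarrow> (\<forall>a\<in>A. a \<sqsubseteq>\<^bsub>DP\<^esub> z)"
    using product_Sup_mem[OF A] product_Sup_bound[OF A] by (intro bexI ballI)
qed simp

lemma product_Sup:
  assumes A: "A \<subseteq> carrier DP"
  shows "\<Squnion>\<^bsub>DP\<^esub>A = (\<lambda>i\<in>I. \<Squnion>\<^bsub>M i\<^esub>((\<lambda>f. f i) ` A))"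
  by (rule sup_lattice.Sup_eqI[OF product_sup_lattice A product_Sup_mem[OF A] product_Sup_bound[OF A]])

lemma product_left_module: "left_module Q DP"
proof (rule left_module.intro[OF quantale_axioms product_sup_lattice], unfold_locales)
  fix q x assume q: "q \<in> carrier Q" and x: "x \<in> carrier DP"
  show closed: "q \<star>\<^bsub>DP\<^esub> x \<in> carrier DP"
    using left_module.act_closed[OF modules q mem[OF x]] by simp
  fix p assume p: "p \<in> carrier Q"
  show "(p \<cdot>\<^bsub>Q\<^esub> q) \<star>\<^bsub>DP\<^esub> x = p \<star>\<^bsub>DP\<^esub> (q \<star>\<^bsub>DP\<^esub> x)"
    using left_module.act_mult[OF modules p q mem[OF x]] by (simp cong: restrict_cong)
next
  fix x assume x: "x \<in> carrier DP"
  show "qone Q \<star>\<^bsub>DP\<^esub> x = x"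
    using left_module.act_one[OF modules mem[OF x]] x
    by (simp add: PiE_def extensional_restrict cong: restrict_cong)
next
  fix q A assume q: "q \<in> carrier Q" and A: "A \<subseteq> carrier DP"
  have "(\<lambda>x. q \<star>\<^bsub>DP\<^esub> x) ` A \<subseteq> carrier DP"
    using left_module.act_closed[OF modules q mem] A by (auto simp del: PiE_iff)
  then show "q \<star>\<^bsub>DP\<^esub> (\<Squnion>\<^bsub>DP\<^esub>A) = \<Squnion>\<^bsub>DP\<^esub>((\<lambda>x. q \<star>\<^bsub>DP\<^esub> x) ` A)"
    using left_module.act_Sup_right[OF modules q component[OF A]]
    by (simp add: product_Sup[OF A] product_Sup image_image cong: restrict_cong)
next
  fix B x assume B: "B \<subseteq> carrier Q" and x: "x \<in> carrier DP"
  have "(\<lambda>q. q \<star>\<^bsub>DP\<^esub> x) ` B \<subseteq> carrier DP"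
    using left_module.act_closed[OF modules _ mem[OF x]] B by auto
  moreover have "(\<Squnion>\<^bsub>Q\<^esub>B) \<star>\<^bsub>M i\<^esub> x i = \<Squnion>\<^bsub>M i\<^esub>((\<lambda>q. q \<star>\<^bsub>M i\<^esub> x i) ` B)" if "i \<in> I" for i
    by (rule left_module.act_Sup_left[OF modules[OF that] B mem[OF x that]])
  ultimately show "(\<Squnion>\<^bsub>Q\<^esub>B) \<star>\<^bsub>DP\<^esub> x = \<Squnion>\<^bsub>DP\<^esub>((\<lambda>q. q \<star>\<^bsub>DP\<^esub> x) ` B)"
    by (simp add: product_Sup image_image cong: restrict_cong)
qed

abbreviation "pin \<equiv> product_injection I M"

lemma bot_closed: "i \<in> I \<Longrightarrow> \<Squnion>\<^bsub>M i\<^esub>{} \<in> carrier (M i)"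
  using sup_lattice.Sup_closed[OF lattices, of i "{}"] by simp

lemma injection_closed: "x \<in> carrier (M j) \<Longrightarrow> pin j x \<in> carrier DP"
  using bot_closed by (auto simp: product_injection_def)

lemma injection_hom:
  assumes j: "j \<in> I"
  shows "pin j \<in> qmod_hom Q (M j) DP"
proof (rule qmod_homI)
  fix A assume A: "A \<subseteq> carrier (M j)"
  have sub: "pin j ` A \<subseteq> carrier DP"
    using A injection_closed by blast
  have "(if i = j then \<Squnion>\<^bsub>M j\<^esub>A else \<Squnion>\<^bsub>M i\<^esub>{}) = \<Squnion>\<^bsub>M i\<^esub>((\<lambda>x. if i = j then x else \<Squnion>\<^bsub>M i\<^esub>{}) ` A)"
    if i: "i \<in> I" for i
  proof (cases "i = j")
    case False
    have "(\<lambda>x. if i = j then x else \<Squnion>\<^bsub>M i\<^esub>{}) ` A \<subseteq> {\<Squnion>\<^bsub>M i\<^esub>{}}"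
      using False by auto
    then have "(\<lambda>x. if i = j then x else \<Squnion>\<^bsub>M i\<^esub>{}) ` A = {} \<or>
        (\<lambda>x. if i = j then x else \<Squnion>\<^bsub>M i\<^esub>{}) ` A = {\<Squnion>\<^bsub>M i\<^esub>{}}"
      by (rule subset_singletonD)
    then show ?thesis
      using False sup_lattice.Sup_singleton[OF lattices[OF i] bot_closed[OF i]] by auto
  qed simp
  then have "pin j (\<Squnion>\<^bsub>M j\<^esub>A) = (\<lambda>i\<in>I. \<Squnion>\<^bsub>M i\<^esub>((\<lambda>x. if i = j then x else \<Squnion>\<^bsub>M i\<^esub>{}) ` A))"
    unfolding product_injection_def by (intro restrict_ext) metis
  also have "\<dots> = \<Squnion>\<^bsub>DP\<^esub>(pin j ` A)"
    unfolding product_Sup[OF sub] image_image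
    by (intro restrict_ext) (simp add: product_injection_def)
  finally show "pin j (\<Squnion>\<^bsub>M j\<^esub>A) = \<Squnion>\<^bsub>DP\<^esub>(pin j ` A)" .
next
  fix q x assume q: "q \<in> carrier Q"
  have "q \<star>\<^bsub>M i\<^esub> (\<Squnion>\<^bsub>M i\<^esub>{}) = \<Squnion>\<^bsub>M i\<^esub>{}" if "i \<in> I" for i
    using left_module.act_Sup_right[OF modules[OF that] q, of "{}"] by simp
  then show "pin j (q \<star>\<^bsub>M j\<^esub> x) = q \<star>\<^bsub>DP\<^esub> pin j x"
    by (auto intro!: restrict_ext simp: product_injection_def)
qed (rule injection_closed)

lemma product_decomp:
  assumes p: "p \<in> carrier DP"
  shows "p = \<Squnion>\<^bsub>DP\<^esub>((\<lambda>i. pin i (p i)) ` I)"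
proof (rule sup_lattice.Sup_eqI[OF product_sup_lattice _ p, symmetric])
  show "(\<lambda>i. pin i (p i)) ` I \<subseteq> carrier DP"
    using injection_closed mem[OF p] by blast
  fix z assume z: "z \<in> carrier DP"
  have bot: "\<Squnion>\<^bsub>M i\<^esub>{} \<sqsubseteq>\<^bsub>M i\<^esub> z i" if "i \<in> I" for i
    using sup_lattice.Sup_le_iff[OF lattices[OF that], of "{}" "z i"] z that by auto
  show "p \<sqsubseteq>\<^bsub>DP\<^esub> z \<longleftrightarrow> (\<forall>a\<in>(\<lambda>i. pin i (p i)) ` I. a \<sqsubseteq>\<^bsub>DP\<^esub> z)"
    using bot by (auto simp: product_injection_def split: if_splits)
qed

theorem product_coproduct: "coproduct_wrt TYPE('n) Q I M DP pin"
  unfolding coproduct_wrt_def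
proof (intro conjI ballI allI impI)
  fix N :: "('q, 'n) qmodule" and f
  assume N: "left_module Q N" and f: "\<forall>i\<in>I. f i \<in> qmod_hom Q (M i) N"
  interpret N: left_module Q N by (rule N)
  note fc = qmod_hom_closed[OF bspec[OF f]]
  define h where "h p = \<Squnion>\<^bsub>N\<^esub>((\<lambda>i. f i (p i)) ` I)" for p
  have sub: "(\<lambda>i. f i (p i)) ` I \<subseteq> carrier N" if "p \<in> carrier DP" for p
    using that fc by auto
  have closed: "h p \<in> carrier N" if "p \<in> carrier DP" for p
    unfolding h_def by (rule N.Sup_closed[OF sub[OF that]])
  have le: "h p \<sqsubseteq>\<^bsub>N\<^esub> z \<longleftrightarrow> (\<forall>i\<in>I. f i (p i) \<sqsubseteq>\<^bsub>N\<^esub> z)" if "p \<in> carrier DP" "z \<in> carrier N" for p z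
    unfolding h_def using N.Sup_le_iff[OF sub[OF that(1)] that(2)] by simp
  have hom: "h \<in> qmod_hom Q DP N"
  proof (rule qmod_homI)
    fix A assume A: "A \<subseteq> carrier DP"
    have SA: "\<Squnion>\<^bsub>DP\<^esub>A \<in> carrier DP"
      by (rule sup_lattice.Sup_closed[OF product_sup_lattice A])
    show "h (\<Squnion>\<^bsub>DP\<^esub>A) = \<Squnion>\<^bsub>N\<^esub>(h ` A)"
    proof (rule N.Sup_eqI[symmetric])
      show "h ` A \<subseteq> carrier N" using closed A by blast
      show "h (\<Squnion>\<^bsub>DP\<^esub>A) \<in> carrier N" by (rule closed[OF SA])
      fix z assume z: "z \<in> carrier N"
      have "f i ((\<Squnion>\<^bsub>DP\<^esub>A) i) \<sqsubseteq>\<^bsub>N\<^esub> z \<longleftrightarrow> (\<forall>p\<in>A. f i (p i) \<sqsubseteq>\<^bsub>N\<^esub> z)" if i: "i \<in> I" for i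
      proof -
        have "f i ((\<Squnion>\<^bsub>DP\<^esub>A) i) = \<Squnion>\<^bsub>N\<^esub>((\<lambda>p. f i (p i)) ` A)"
          using qmod_hom_Sup[OF bspec[OF f i] component[OF A i]] i
          by (simp add: product_Sup[OF A] image_image)
        moreover have "(\<lambda>p. f i (p i)) ` A \<subseteq> carrier N"
          using fc[OF i] component[OF A i] by blast
        ultimately show ?thesis
          using N.Sup_le_iff[OF _ z] by simp
      qed
      moreover have "\<forall>p\<in>A. p \<in> carrier DP" using A by blast
      ultimately show "h (\<Squnion>\<^bsub>DP\<^esub>A) \<sqsubseteq>\<^bsub>N\<^esub> z \<longleftrightarrow> (\<forall>a\<in>h ` A. a \<sqsubseteq>\<^bsub>N\<^esub> z)"
        using le[OF SA z] le[OF _ z] by auto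
    qed
  next
    fix q p assume q: "q \<in> carrier Q" and p: "p \<in> carrier DP"
    have "f i ((q \<star>\<^bsub>DP\<^esub> p) i) = q \<star>\<^bsub>N\<^esub> f i (p i)" if "i \<in> I" for i
      using qmod_hom_act[OF bspec[OF f that] q] p that by auto
    then have "h (q \<star>\<^bsub>DP\<^esub> p) = \<Squnion>\<^bsub>N\<^esub>((\<lambda>i. q \<star>\<^bsub>N\<^esub> f i (p i)) ` I)"
      unfolding h_def by (simp cong: image_cong)
    then show "h (q \<star>\<^bsub>DP\<^esub> p) = q \<star>\<^bsub>N\<^esub> h p"
      unfolding h_def by (simp add: N.act_Sup_right[OF q sub[OF p]] image_image)
  qed (rule closed)
  have pin: "h (pin j x) = f j x" if j: "j \<in> I" and x: "x \<in> carrier (M j)" for j x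
  proof (rule N.eq_by_upper_bounds)
    show "h (pin j x) \<in> carrier N" by (rule closed[OF injection_closed[OF x]])
    show "f j x \<in> carrier N" by (rule fc[OF j x])
    fix z assume z: "z \<in> carrier N"
    have "f i (\<Squnion>\<^bsub>M i\<^esub>{}) \<sqsubseteq>\<^bsub>N\<^esub> z" if "i \<in> I" for i
      using qmod_hom_Sup[OF bspec[OF f that], of "{}"] N.Sup_le_iff[of "{}" z] z by simp
    then show "h (pin j x) \<sqsubseteq>\<^bsub>N\<^esub> z \<longleftrightarrow> f j x \<sqsubseteq>\<^bsub>N\<^esub> z"
      unfolding le[OF injection_closed[OF x] z]
      using j by (auto simp: product_injection_def)
  qed
  show "\<exists>h\<in>qmod_hom Q DP N. (\<forall>i\<in>I. \<forall>x\<in>carrier (M i). h (pin i x) = f i x) \<and>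
      (\<forall>h'\<in>qmod_hom Q DP N. (\<forall>i\<in>I. \<forall>x\<in>carrier (M i). h' (pin i x) = f i x) \<longrightarrow>
        (\<forall>c\<in>carrier DP. h' c = h c))"
  proof (intro bexI[OF _ hom] conjI ballI impI)
    fix h' p assume h': "h' \<in> qmod_hom Q DP N" and p: "p \<in> carrier DP"
      and eq: "\<forall>i\<in>I. \<forall>x\<in>carrier (M i). h' (pin i x) = f i x"
    have pi: "p i \<in> carrier (M i)" if "i \<in> I" for i
      using p that by auto
    have "h' p = h' (\<Squnion>\<^bsub>DP\<^esub>((\<lambda>i. pin i (p i)) ` I))"
      using product_decomp[OF p] by simp
    also have "\<dots> = \<Squnion>\<^bsub>N\<^esub>(h' ` (\<lambda>i. pin i (p i)) ` I)"
      by (rule qmod_hom_Sup[OF h']) (use pi injection_closed in blast)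
    also have "\<dots> = h p"
      unfolding h_def image_image using eq pi by (simp cong: image_cong)
    finally show "h' p = h p" .
  qed (rule pin)
qed (use modules product_left_module injection_hom in auto)

end

theorem coproduct_any_type:
  fixes M :: "'i \<Rightarrow> ('q, 'm) qmodule" and C :: "('q, 'c) qmodule"
  assumes "coproduct Q I M C \<iota>"
  shows "coproduct_wrt TYPE('n) Q I M C \<iota>"
proof -
  have C1: "coproduct_wrt TYPE('i \<Rightarrow> 'm) Q I M C \<iota>" and C2: "coproduct_wrt TYPE('c) Q I M C \<iota>"
    using assms by (auto simp: coproduct_def)
  have mods: "\<forall>i\<in>I. left_module Q (M i)" and C: "left_module Q C"
    and \<iota>: "\<forall>i\<in>I. \<iota> i \<in> qmod_hom Q (M i) C"
    using C1 unfolding coproduct_wrt_def by auto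
  interpret module_family Q I M
    using mods left_module.axioms(1)[OF C] by (simp add: module_family_def module_family_axioms_def)
  obtain a where a: "a \<in> qmod_hom Q C DP" "\<forall>i\<in>I. \<forall>x\<in>carrier (M i). a (\<iota> i x) = pin i x"
    using coproduct_lift[OF C1 product_left_module, of pin] injection_hom by auto
  obtain b where b: "b \<in> qmod_hom Q DP C" "\<forall>i\<in>I. \<forall>x\<in>carrier (M i). b (pin i x) = \<iota> i x"
    using coproduct_lift[OF product_coproduct C, of \<iota>] \<iota> by auto
  have ba: "b (a c) = c" if "c \<in> carrier C" for c
    by (rule coproduct_unique[OF C2 C qmod_hom_comp[OF a(1) b(1)] qmod_hom_id _ that])
      (simp add: a(2) b(2))
  show ?thesis
    unfolding coproduct_wrt_def
  proof (intro conjI allI impI mods C \<iota>)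
    fix N :: "('q, 'n) qmodule" and f
    assume N: "left_module Q N" and f: "\<forall>i\<in>I. f i \<in> qmod_hom Q (M i) N"
    obtain h where h: "h \<in> qmod_hom Q DP N" "\<forall>i\<in>I. \<forall>x\<in>carrier (M i). h (pin i x) = f i x"
      using coproduct_lift[OF product_coproduct N, of f] f by auto
    show "\<exists>h\<in>qmod_hom Q C N. (\<forall>i\<in>I. \<forall>x\<in>carrier (M i). h (\<iota> i x) = f i x) \<and>
        (\<forall>h'\<in>qmod_hom Q C N. (\<forall>i\<in>I. \<forall>x\<in>carrier (M i). h' (\<iota> i x) = f i x) \<longrightarrow>
          (\<forall>c\<in>carrier C. h' c = h c))"
    proof (intro bexI[OF _ qmod_hom_comp[OF a(1) h(1)]] conjI ballI impI)
      fix h' c assume h': "h' \<in> qmod_hom Q C N" and c: "c \<in> carrier C"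
        and eq: "\<forall>i\<in>I. \<forall>x\<in>carrier (M i). h' (\<iota> i x) = f i x"
      have "h' (b (a c)) = h (a c)"
        by (rule coproduct_unique[OF product_coproduct N qmod_hom_comp[OF b(1) h'] h(1) _
              qmod_hom_closed[OF a(1) c]]) (simp add: b(2) eq h(2))
      then show "h' c = h (a c)" by (simp add: ba[OF c])
    qed (use a h in auto)
  qed
qed

subsection \<open>Projective modules are retracts of free modules\<close>

lemma left_regular_sel [simp]:
  "carrier (left_regular R) = carrier R" "eq (left_regular R) = eq R"
  "le (left_regular R) = le R" "act (left_regular R) q x = q \<cdot>\<^bsub>R\<^esub> x"
  by (simp_all add: left_regular_def)

lemma right_regular_sel [simp]:
  "carrier (right_regular R) = carrier R" "eq (right_regular R) = eq R"
  "le (right_regular R) = le R" "act (right_regular R) q x = x \<cdot>\<^bsub>R\<^esub> q"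
  by (simp_all add: right_regular_def)

lemma Sup_regular [simp]:
  "\<Squnion>\<^bsub>left_regular R\<^esub>A = \<Squnion>\<^bsub>R\<^esub>A" "\<Squnion>\<^bsub>right_regular R\<^esub>A = \<Squnion>\<^bsub>R\<^esub>A"
  by (rule Sup_cong; simp)+

lemma (in sup_lattice) sup_lattice_cong:
  assumes "carrier K = carrier L" "le K = le L" "eq K = eq L"
  shows "sup_lattice K"
proof (rule sup_latticeI)
  fix A assume "A \<subseteq> carrier K"
  then have "A \<subseteq> carrier L" by (simp add: assms)
  then show "\<exists>s\<in>carrier K. \<forall>z\<in>carrier K. s \<sqsubseteq>\<^bsub>K\<^esub> z \<longleftrightarrow> (\<forall>a\<in>A. a \<sqsubseteq>\<^bsub>K\<^esub> z)"
    using Sup_closed Sup_le_iff by (intro bexI[of _ "\<Squnion>A"]) (auto simp: assms)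
qed (auto simp: assms eq_is_equal intro: antisym le_trans)

lemma left_regular_module:
  assumes "quantale R"
  shows "left_module R (left_regular R)"
proof -
  interpret quantale R by (rule assms)
  show ?thesis
    by (intro left_module.intro left_module_axioms.intro quantale_axioms sup_lattice_cong)
      (simp_all add: mult_assoc mult_Sup_left mult_Sup_right)
qed

theorem projective_any_type:
  fixes M :: "('q, 'm) qmodule"
  assumes M: "left_module Q M" and proj: "projective Q M"
  shows "projective_wrt TYPE('n) TYPE('p) Q M"
  unfolding projective_wrt_def
proof (intro allI impI)
  interpret M: left_module Q M by (rule M)
  interpret module_family Q "carrier M" "\<lambda>_. left_regular Q"
    by (intro module_family.intro module_family_axioms.intro M.quantale_axioms left_regular_module)
  have scalar: "(\<lambda>q. q \<star>\<^bsub>N\<^esub> y) \<in> qmod_hom Q (left_regular Q) N"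
    if "left_module Q N" "y \<in> carrier N" for y and N :: "('q, 'x) qmodule"
    using that by (intro qmod_homI)
      (simp_all add: left_module.act_closed left_module.act_Sup_left left_module.act_mult)
  obtain g where g: "g \<in> qmod_hom Q DP M"
      "\<forall>x\<in>carrier M. \<forall>q\<in>carrier (left_regular Q). g (pin x q) = q \<star>\<^bsub>M\<^esub> x"
    using coproduct_lift[OF product_coproduct M, of "\<lambda>x q. q \<star>\<^bsub>M\<^esub> x"] scalar[OF M] by auto
  have "g ` carrier DP = carrier M"
  proof
    show "g ` carrier DP \<subseteq> carrier M"
      using qmod_hom_closed[OF g(1)] by blast
    show "carrier M \<subseteq> g ` carrier DP"
    proof
      fix x assume x: "x \<in> carrier M"
      have "x = g (pin x (qone Q))"
        by (simp add: g(2) x M.act_one)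
      then show "x \<in> g ` carrier DP"
        using injection_closed[of "qone Q" x] by (intro image_eqI) simp_all
    qed
  qed
  then have "\<exists>s\<in>qmod_hom Q M DP. \<forall>x\<in>carrier M. g (s x) = x"
    using proj[unfolded projective_def projective_wrt_def, rule_format,
        OF product_left_module M g(1) _ qmod_hom_id] by blast
  then obtain s where s: "s \<in> qmod_hom Q M DP" "\<And>x. x \<in> carrier M \<Longrightarrow> g (s x) = x"
    by blast
  fix N :: "('q, 'n) qmodule" and P :: "('q, 'p) qmodule" and u f
  assume N: "left_module Q N" and P: "left_module Q P" and u: "u \<in> qmod_hom Q N P"
    and surj: "u ` carrier N = carrier P" and f: "f \<in> qmod_hom Q M P"
  have "\<forall>x\<in>carrier M. \<exists>y\<in>carrier N. u y = f x"
    using qmod_hom_closed[OF f] surj by (metis imageE)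
  then obtain y where y: "\<forall>x\<in>carrier M. y x \<in> carrier N \<and> u (y x) = f x"
    by metis
  then have yN: "y x \<in> carrier N" and uy: "u (y x) = f x" if "x \<in> carrier M" for x
    using that by auto
  obtain k where k: "k \<in> qmod_hom Q DP N"
      "\<forall>x\<in>carrier M. \<forall>q\<in>carrier (left_regular Q). k (pin x q) = q \<star>\<^bsub>N\<^esub> y x"
    using coproduct_lift[OF product_coproduct N, of "\<lambda>x q. q \<star>\<^bsub>N\<^esub> y x"] scalar[OF N yN] by auto
  have "u (k c) = f (g c)" if c: "c \<in> carrier DP" for c
    by (rule coproduct_unique[OF product_coproduct P qmod_hom_comp[OF k(1) u]
          qmod_hom_comp[OF g(1) f] _ c])
      (simp add: k(2) g(2) uy yN qmod_hom_act[OF u] qmod_hom_act[OF f])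
  then show "\<exists>h\<in>qmod_hom Q M N. \<forall>x\<in>carrier M. u (h x) = f x"
    using s(2) qmod_hom_closed[OF s(1)] by (intro bexI[OF _ qmod_hom_comp[OF s(1) k(1)]] ballI) simp
qed

subsection \<open>Existence of tensor products\<close>

text \<open>The tensor product is realised by the sets of pairs that are saturated with respect to the
  defining relations, ordered by inclusion.  The action \<open>\<alpha>\<close> is irrelevant for the sup-lattice.\<close>

definition saturated ::
  "'q quantale \<Rightarrow> ('q, 'a) qmodule \<Rightarrow> ('q, 'b) qmodule \<Rightarrow> ('a \<times> 'b) set \<Rightarrow> bool" where
  "saturated Q X Y C \<longleftrightarrow> C \<subseteq> carrier X \<times> carrier Y \<and>
     (\<forall>A\<subseteq>carrier X. \<forall>y\<in>carrier Y. (\<Squnion>\<^bsub>X\<^esub>A, y) \<in> C \<longleftrightarrow> (\<forall>x\<in>A. (x, y) \<in> C)) \<and>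
     (\<forall>x\<in>carrier X. \<forall>B\<subseteq>carrier Y. (x, \<Squnion>\<^bsub>Y\<^esub>B) \<in> C \<longleftrightarrow> (\<forall>y\<in>B. (x, y) \<in> C)) \<and>
     (\<forall>q\<in>carrier Q. \<forall>x\<in>carrier X. \<forall>y\<in>carrier Y. (q \<star>\<^bsub>X\<^esub> x, y) \<in> C \<longleftrightarrow> (x, q \<star>\<^bsub>Y\<^esub> y) \<in> C)"

definition saturation ::
  "'q quantale \<Rightarrow> ('q, 'a) qmodule \<Rightarrow> ('q, 'b) qmodule \<Rightarrow> ('a \<times> 'b) set \<Rightarrow> ('a \<times> 'b) set" where
  "saturation Q X Y S = \<Inter>{C. saturated Q X Y C \<and> S \<subseteq> C}"

definition tensor_lattice ::
  "'q quantale \<Rightarrow> ('q, 'a) qmodule \<Rightarrow> ('q, 'b) qmodule \<Rightarrow>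
     ('r \<Rightarrow> ('a \<times> 'b) set \<Rightarrow> ('a \<times> 'b) set) \<Rightarrow> ('r, ('a \<times> 'b) set) qmodule" where
  "tensor_lattice Q X Y \<alpha> =
     \<lparr>carrier = {C. saturated Q X Y C}, eq = (=), le = (\<subseteq>), act = \<alpha>\<rparr>"

lemma tensor_lattice_sel [simp]:
  "carrier (tensor_lattice Q X Y \<alpha>) = {C. saturated Q X Y C}"
  "eq (tensor_lattice Q X Y \<alpha>) = (=)" "le (tensor_lattice Q X Y \<alpha>) = (\<subseteq>)"
  "act (tensor_lattice Q X Y \<alpha>) = \<alpha>"
  by (simp_all add: tensor_lattice_def)

lemma saturatedD:
  assumes "saturated Q X Y C"
  shows "C \<subseteq> carrier X \<times> carrier Y"
    "A \<subseteq> carrier X \<Longrightarrow> y \<in> carrier Y \<Longrightarrow> (\<Squnion>\<^bsub>X\<^esub>A, y) \<in> C \<longleftrightarrow> (\<forall>x\<in>A. (x, y) \<in> C)"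
    "x \<in> carrier X \<Longrightarrow> B \<subseteq> carrier Y \<Longrightarrow> (x, \<Squnion>\<^bsub>Y\<^esub>B) \<in> C \<longleftrightarrow> (\<forall>y\<in>B. (x, y) \<in> C)"
    "q \<in> carrier Q \<Longrightarrow> x \<in> carrier X \<Longrightarrow> y \<in> carrier Y \<Longrightarrow>
       (q \<star>\<^bsub>X\<^esub> x, y) \<in> C \<longleftrightarrow> (x, q \<star>\<^bsub>Y\<^esub> y) \<in> C"
  using assms by (simp_all add: saturated_def)

lemma saturatedI:
  assumes "C \<subseteq> carrier X \<times> carrier Y"
    "\<And>A y. A \<subseteq> carrier X \<Longrightarrow> y \<in> carrier Y \<Longrightarrow> (\<Squnion>\<^bsub>X\<^esub>A, y) \<in> C \<longleftrightarrow> (\<forall>x\<in>A. (x, y) \<in> C)"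
    "\<And>x B. x \<in> carrier X \<Longrightarrow> B \<subseteq> carrier Y \<Longrightarrow> (x, \<Squnion>\<^bsub>Y\<^esub>B) \<in> C \<longleftrightarrow> (\<forall>y\<in>B. (x, y) \<in> C)"
    "\<And>q x y. q \<in> carrier Q \<Longrightarrow> x \<in> carrier X \<Longrightarrow> y \<in> carrier Y \<Longrightarrow>
       (q \<star>\<^bsub>X\<^esub> x, y) \<in> C \<longleftrightarrow> (x, q \<star>\<^bsub>Y\<^esub> y) \<in> C"
  shows "saturated Q X Y C"
  unfolding saturated_def by (intro conjI allI ballI impI assms)

lemma balanced_mapD:
  assumes "f \<in> balanced_map Q X Y L"
  shows "y \<in> carrier Y \<Longrightarrow> (\<lambda>x. f x y) \<in> sup_hom X L"
    "x \<in> carrier X \<Longrightarrow> f x \<in> sup_hom Y L"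
    "q \<in> carrier Q \<Longrightarrow> x \<in> carrier X \<Longrightarrow> y \<in> carrier Y \<Longrightarrow> f (q \<star>\<^bsub>X\<^esub> x) y = f x (q \<star>\<^bsub>Y\<^esub> y)"
    "x \<in> carrier X \<Longrightarrow> y \<in> carrier Y \<Longrightarrow> f x y \<in> carrier L"
  using assms by (auto simp: balanced_map_def sup_hom_def)

locale tensor_setting = X: right_module Q X + Y: left_module Q Y
  for Q :: "'q quantale" and X :: "('q, 'a) qmodule" and Y :: "('q, 'b) qmodule"
begin

abbreviation "sat \<equiv> saturated Q X Y"
abbreviation "cl \<equiv> saturation Q X Y"
abbreviation "tens x y \<equiv> cl {(x, y)}"

lemma sat_top: "sat (carrier X \<times> carrier Y)"
  by (rule saturatedI) (auto simp: X.act_closed Y.act_closed)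

lemma sat_Inter:
  assumes F: "\<And>C. C \<in> F \<Longrightarrow> sat C" and ne: "F \<noteq> {}"
  shows "sat (\<Inter>F)"
proof (rule saturatedI)
  show "\<Inter>F \<subseteq> carrier X \<times> carrier Y"
    using ne by (intro Inter_subset saturatedD(1)[OF F])
  fix A y assume "A \<subseteq> carrier X" "y \<in> carrier Y"
  then have "\<forall>C\<in>F. (\<Squnion>\<^bsub>X\<^esub>A, y) \<in> C \<longleftrightarrow> (\<forall>x\<in>A. (x, y) \<in> C)"
    by (intro ballI saturatedD(2)[OF F])
  then show "(\<Squnion>\<^bsub>X\<^esub>A, y) \<in> \<Inter>F \<longleftrightarrow> (\<forall>x\<in>A. (x, y) \<in> \<Inter>F)" by blast
next
  fix x B assume "x \<in> carrier X" "B \<subseteq> carrier Y"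
  then have "\<forall>C\<in>F. (x, \<Squnion>\<^bsub>Y\<^esub>B) \<in> C \<longleftrightarrow> (\<forall>y\<in>B. (x, y) \<in> C)"
    by (intro ballI saturatedD(3)[OF F])
  then show "(x, \<Squnion>\<^bsub>Y\<^esub>B) \<in> \<Inter>F \<longleftrightarrow> (\<forall>y\<in>B. (x, y) \<in> \<Inter>F)" by blast
next
  fix q x y assume "q \<in> carrier Q" "x \<in> carrier X" "y \<in> carrier Y"
  then have "\<forall>C\<in>F. (q \<star>\<^bsub>X\<^esub> x, y) \<in> C \<longleftrightarrow> (x, q \<star>\<^bsub>Y\<^esub> y) \<in> C"
    by (intro ballI saturatedD(4)[OF F])
  then show "(q \<star>\<^bsub>X\<^esub> x, y) \<in> \<Inter>F \<longleftrightarrow> (x, q \<star>\<^bsub>Y\<^esub> y) \<in> \<Inter>F" by blast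
qed

lemma sat_cl: "S \<subseteq> carrier X \<times> carrier Y \<Longrightarrow> sat (cl S)"
  unfolding saturation_def using sat_top by (intro sat_Inter) auto

lemma cl_le: "sat C \<Longrightarrow> cl S \<subseteq> C \<longleftrightarrow> S \<subseteq> C"
  unfolding saturation_def by blast

lemma sat_tens: "x \<in> carrier X \<Longrightarrow> y \<in> carrier Y \<Longrightarrow> sat (tens x y)"
  by (rule sat_cl) simp

lemma tens_le: "sat C \<Longrightarrow> tens x y \<subseteq> C \<longleftrightarrow> (x, y) \<in> C"
  by (simp add: cl_le)

lemma Union_le:
  assumes "\<And>C. C \<in> \<A> \<Longrightarrow> sat C"
  shows "\<Union>\<A> \<subseteq> carrier X \<times> carrier Y"
  using saturatedD(1)[OF assms] by (rule Union_least)

lemma tensor_sup_lattice: "sup_lattice (tensor_lattice Q X Y \<alpha>)"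
proof (rule sup_latticeI)
  fix \<A> assume "\<A> \<subseteq> carrier (tensor_lattice Q X Y \<alpha>)"
  then have "\<Union>\<A> \<subseteq> carrier X \<times> carrier Y" by (intro Union_le) auto
  then show "\<exists>s\<in>carrier (tensor_lattice Q X Y \<alpha>). \<forall>z\<in>carrier (tensor_lattice Q X Y \<alpha>).
      s \<sqsubseteq>\<^bsub>tensor_lattice Q X Y \<alpha>\<^esub> z \<longleftrightarrow> (\<forall>a\<in>\<A>. a \<sqsubseteq>\<^bsub>tensor_lattice Q X Y \<alpha>\<^esub> z)"
    by (intro bexI[of _ "cl (\<Union>\<A>)"]) (auto simp: cl_le sat_cl)
qed auto

lemma tensor_SupI:
  assumes "\<And>C. C \<in> \<A> \<Longrightarrow> sat C" "sat S" "\<And>Z. sat Z \<Longrightarrow> S \<subseteq> Z \<longleftrightarrow> (\<forall>C\<in>\<A>. C \<subseteq> Z)"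
  shows "\<Squnion>\<^bsub>tensor_lattice Q X Y \<alpha>\<^esub>\<A> = S"
  by (rule sup_lattice.Sup_eqI[OF tensor_sup_lattice]) (use assms in auto)

lemma tensor_Sup:
  assumes "\<And>C. C \<in> \<A> \<Longrightarrow> sat C"
  shows "\<Squnion>\<^bsub>tensor_lattice Q X Y \<alpha>\<^esub>\<A> = cl (\<Union>\<A>)"
  by (rule tensor_SupI[OF assms sat_cl[OF Union_le[OF assms]]]) (simp_all add: cl_le Sup_le_iff)

lemma tensor_Sup_tens:
  assumes "S \<subseteq> carrier X \<times> carrier Y"
  shows "\<Squnion>\<^bsub>tensor_lattice Q X Y \<alpha>\<^esub>{tens x y | x y. (x, y) \<in> S} = cl S"
proof (rule tensor_SupI)
  fix C assume "C \<in> {tens x y | x y. (x, y) \<in> S}"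
  then show "sat C" using assms sat_tens by auto
next
  fix Z assume Z: "sat Z"
  show "cl S \<subseteq> Z \<longleftrightarrow> (\<forall>C\<in>{tens x y | x y. (x, y) \<in> S}. C \<subseteq> Z)"
  proof -
    have "(\<forall>C\<in>{tens x y | x y. (x, y) \<in> S}. C \<subseteq> Z) \<longleftrightarrow> (\<forall>x y. (x, y) \<in> S \<longrightarrow> tens x y \<subseteq> Z)"
      by blast
    then show ?thesis
      unfolding cl_le[OF Z] tens_le[OF Z] by auto
  qed
qed (rule sat_cl[OF assms])

lemma eq_by_sat:
  assumes "sat C" "sat D" "\<And>Z. sat Z \<Longrightarrow> C \<subseteq> Z \<longleftrightarrow> D \<subseteq> Z"
  shows "C = D"
  using assms(3)[OF assms(1)] assms(3)[OF assms(2)] by auto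

lemma tens_balanced: "tens \<in> balanced_map Q X Y (tensor_lattice Q X Y \<alpha>)"
  unfolding balanced_map_def
proof (intro CollectI conjI ballI sup_homI)
  fix y A assume y: "y \<in> carrier Y" and A: "A \<subseteq> carrier X"
  show "tens (\<Squnion>\<^bsub>X\<^esub>A) y = \<Squnion>\<^bsub>tensor_lattice Q X Y \<alpha>\<^esub>((\<lambda>x. tens x y) ` A)"
  proof (rule tensor_SupI[symmetric])
    fix Z assume Z: "sat Z"
    show "tens (\<Squnion>\<^bsub>X\<^esub>A) y \<subseteq> Z \<longleftrightarrow> (\<forall>C\<in>(\<lambda>x. tens x y) ` A. C \<subseteq> Z)"
      by (simp add: tens_le[OF Z] saturatedD(2)[OF Z A y])
  qed (use A y sat_tens in auto)
next
  fix x B assume x: "x \<in> carrier X" and B: "B \<subseteq> carrier Y"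
  show "tens x (\<Squnion>\<^bsub>Y\<^esub>B) = \<Squnion>\<^bsub>tensor_lattice Q X Y \<alpha>\<^esub>(tens x ` B)"
  proof (rule tensor_SupI[symmetric])
    fix Z assume Z: "sat Z"
    show "tens x (\<Squnion>\<^bsub>Y\<^esub>B) \<subseteq> Z \<longleftrightarrow> (\<forall>C\<in>tens x ` B. C \<subseteq> Z)"
      by (simp add: tens_le[OF Z] saturatedD(3)[OF Z x B])
  qed (use x B sat_tens in auto)
next
  fix q x y assume q: "q \<in> carrier Q" and x: "x \<in> carrier X" and y: "y \<in> carrier Y"
  show "tens (q \<star>\<^bsub>X\<^esub> x) y = tens x (q \<star>\<^bsub>Y\<^esub> y)"
  proof (rule eq_by_sat)
    fix Z assume Z: "sat Z"
    show "tens (q \<star>\<^bsub>X\<^esub> x) y \<subseteq> Z \<longleftrightarrow> tens x (q \<star>\<^bsub>Y\<^esub> y) \<subseteq> Z"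
      by (simp add: tens_le[OF Z] saturatedD(4)[OF Z q x y])
  qed (simp_all add: sat_tens X.act_closed Y.act_closed q x y)
qed (simp_all add: sat_tens)

theorem tensor_lattice_tensor_product:
  "tensor_product_wrt TYPE('l) Q X Y (tensor_lattice Q X Y \<alpha>) tens"
  unfolding tensor_product_wrt_def
proof (intro conjI allI impI tens_balanced tensor_sup_lattice X.right_module_axioms
    Y.left_module_axioms)
  let ?T = "tensor_lattice Q X Y \<alpha>"
  fix L :: "'l gorder" and f
  assume L: "sup_lattice L" and f: "f \<in> balanced_map Q X Y L"
  interpret L: sup_lattice L by (rule L)
  note fc = balanced_mapD(4)[OF f]
  define h where "h C = \<Squnion>\<^bsub>L\<^esub>{f x y | x y. (x, y) \<in> C}" for C
  define K where "K z = {(x, y) \<in> carrier X \<times> carrier Y. f x y \<sqsubseteq>\<^bsub>L\<^esub> z}" for z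
  have sub: "{f x y | x y. (x, y) \<in> C} \<subseteq> carrier L" if "sat C" for C
    using saturatedD(1)[OF that] fc by auto
  have closed: "h C \<in> carrier L" if "sat C" for C
    unfolding h_def by (rule L.Sup_closed[OF sub[OF that]])
  have satK: "sat (K z)" if z: "z \<in> carrier L" for z
  proof (rule saturatedI)
    fix A y assume A: "A \<subseteq> carrier X" and y: "y \<in> carrier Y"
    have "(\<lambda>x. f x y) ` A \<subseteq> carrier L" using A y fc by auto
    then have "f (\<Squnion>\<^bsub>X\<^esub>A) y \<sqsubseteq>\<^bsub>L\<^esub> z \<longleftrightarrow> (\<forall>x\<in>A. f x y \<sqsubseteq>\<^bsub>L\<^esub> z)"
      using sup_hom_Sup[OF balanced_mapD(1)[OF f y] A] L.Sup_le_iff[OF _ z] by simp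
    then show "(\<Squnion>\<^bsub>X\<^esub>A, y) \<in> K z \<longleftrightarrow> (\<forall>x\<in>A. (x, y) \<in> K z)"
      using A y X.Sup_closed[OF A] by (auto simp: K_def)
  next
    fix x B assume x: "x \<in> carrier X" and B: "B \<subseteq> carrier Y"
    have "f x ` B \<subseteq> carrier L" using B x fc by auto
    then have "f x (\<Squnion>\<^bsub>Y\<^esub>B) \<sqsubseteq>\<^bsub>L\<^esub> z \<longleftrightarrow> (\<forall>y\<in>B. f x y \<sqsubseteq>\<^bsub>L\<^esub> z)"
      using sup_hom_Sup[OF balanced_mapD(2)[OF f x] B] L.Sup_le_iff[OF _ z] by simp
    then show "(x, \<Squnion>\<^bsub>Y\<^esub>B) \<in> K z \<longleftrightarrow> (\<forall>y\<in>B. (x, y) \<in> K z)"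
      using B x Y.Sup_closed[OF B] by (auto simp: K_def)
  next
    fix q x y assume "q \<in> carrier Q" "x \<in> carrier X" "y \<in> carrier Y"
    then show "(q \<star>\<^bsub>X\<^esub> x, y) \<in> K z \<longleftrightarrow> (x, q \<star>\<^bsub>Y\<^esub> y) \<in> K z"
      using balanced_mapD(3)[OF f] by (simp add: K_def X.act_closed Y.act_closed)
  qed (auto simp: K_def)
  have le: "h C \<sqsubseteq>\<^bsub>L\<^esub> z \<longleftrightarrow> C \<subseteq> K z" if C: "sat C" and z: "z \<in> carrier L" for C z
  proof -
    have "h C \<sqsubseteq>\<^bsub>L\<^esub> z \<longleftrightarrow> (\<forall>x y. (x, y) \<in> C \<longrightarrow> f x y \<sqsubseteq>\<^bsub>L\<^esub> z)"
      unfolding h_def L.Sup_le_iff[OF sub[OF C] z] by blast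
    then show ?thesis using saturatedD(1)[OF C] by (auto simp: K_def)
  qed
  have hom: "h \<in> sup_hom ?T L"
  proof (rule sup_homI)
    fix \<A> assume "\<A> \<subseteq> carrier ?T"
    then have \<A>: "\<And>C. C \<in> \<A> \<Longrightarrow> sat C" by auto
    have S: "sat (cl (\<Union>\<A>))" by (rule sat_cl[OF Union_le[OF \<A>]])
    have "\<Squnion>\<^bsub>L\<^esub>(h ` \<A>) = h (cl (\<Union>\<A>))"
    proof (rule L.Sup_eqI)
      fix z assume z: "z \<in> carrier L"
      show "h (cl (\<Union>\<A>)) \<sqsubseteq>\<^bsub>L\<^esub> z \<longleftrightarrow> (\<forall>a\<in>h ` \<A>. a \<sqsubseteq>\<^bsub>L\<^esub> z)"
        by (simp add: le[OF S z] cl_le[OF satK[OF z]] le[OF \<A> z] Sup_le_iff)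
    qed (use closed \<A> S in auto)
    then show "h (\<Squnion>\<^bsub>?T\<^esub>\<A>) = \<Squnion>\<^bsub>L\<^esub>(h ` \<A>)"
      by (simp add: tensor_Sup[OF \<A>])
  qed (use closed in simp)
  show "\<exists>h\<in>sup_hom ?T L. (\<forall>x\<in>carrier X. \<forall>y\<in>carrier Y. h (tens x y) = f x y) \<and>
      (\<forall>h'\<in>sup_hom ?T L. (\<forall>x\<in>carrier X. \<forall>y\<in>carrier Y. h' (tens x y) = f x y) \<longrightarrow>
        (\<forall>t\<in>carrier ?T. h' t = h t))"
  proof (intro bexI[OF _ hom] conjI ballI impI)
    fix x y assume x: "x \<in> carrier X" and y: "y \<in> carrier Y"
    show "h (tens x y) = f x y"
    proof (rule L.eq_by_upper_bounds[OF closed[OF sat_tens[OF x y]] fc[OF x y]])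
      fix z assume z: "z \<in> carrier L"
      show "h (tens x y) \<sqsubseteq>\<^bsub>L\<^esub> z \<longleftrightarrow> f x y \<sqsubseteq>\<^bsub>L\<^esub> z"
        unfolding le[OF sat_tens[OF x y] z] tens_le[OF satK[OF z]] by (simp add: K_def x y)
    qed
  next
    fix h' C assume h': "h' \<in> sup_hom ?T L" and "C \<in> carrier ?T"
      and eq: "\<forall>x\<in>carrier X. \<forall>y\<in>carrier Y. h' (tens x y) = f x y"
    then have C: "sat C" by simp
    note CXY = saturatedD(1)[OF C]
    have "cl C = C"
      using cl_le[OF C, of C] by (auto simp: saturation_def)
    then have "h' C = h' (\<Squnion>\<^bsub>?T\<^esub>{tens x y | x y. (x, y) \<in> C})"
      by (simp add: tensor_Sup_tens[OF CXY])
    also have "\<dots> = \<Squnion>\<^bsub>L\<^esub>(h' ` {tens x y | x y. (x, y) \<in> C})"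
      by (rule sup_hom_Sup[OF h']) (use CXY sat_tens in auto)
    also have "h' ` {tens x y | x y. (x, y) \<in> C} = {h' (tens x y) | x y. (x, y) \<in> C}"
      by blast
    also have "\<dots> = {f x y | x y. (x, y) \<in> C}"
    proof -
      have "h' (tens x y) = f x y" if "(x, y) \<in> C" for x y
        using eq CXY that by auto
      then show ?thesis by (intro Collect_cong ex_cong1) auto
    qed
    finally show "h' C = h C" by (simp add: h_def)
  qed
qed

end

lemma truncate_sel [simp]:
  "carrier (gorder.truncate L) = carrier L" "eq (gorder.truncate L) = eq L"
  "le (gorder.truncate L) = le L"
  by (simp_all add: gorder.truncate_def)

lemma sup_hom_truncate [simp]:
  "sup_hom L (gorder.truncate K) = sup_hom L K" "sup_hom (gorder.truncate L) K = sup_hom L K"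
  by (simp_all add: sup_hom_def Sup_cong[of "gorder.truncate L" L for L])

lemma balanced_map_truncate [simp]:
  "balanced_map Q X Y (gorder.truncate L) = balanced_map Q X Y L"
  by (simp add: balanced_map_def)

lemma balanced_map_comp:
  assumes "f \<in> balanced_map Q X Y L" "h \<in> sup_hom L K"
  shows "(\<lambda>x y. h (f x y)) \<in> balanced_map Q X Y K"
  unfolding balanced_map_def
  by (intro CollectI conjI ballI sup_hom_comp[OF _ assms(2)] arg_cong[of _ _ h]
      balanced_mapD[OF assms(1)])

lemma tensor_lift:
  assumes T: "tensor_product_wrt TYPE('l) Q X Y T \<tau>"
    and L: "sup_lattice (L :: ('l, 'z) gorder_scheme)" and f: "f \<in> balanced_map Q X Y L"
  shows "\<exists>h\<in>sup_hom T L. \<forall>x\<in>carrier X. \<forall>y\<in>carrier Y. h (\<tau> x y) = f x y"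
proof -
  have "sup_lattice (gorder.truncate L)"
    by (rule sup_lattice.sup_lattice_cong[OF L]) simp_all
  moreover have "f \<in> balanced_map Q X Y (gorder.truncate L)"
    using f by simp
  ultimately have "\<exists>h \<in> sup_hom T (gorder.truncate L).
          (\<forall>x\<in>carrier X. \<forall>y\<in>carrier Y. h (\<tau> x y) = f x y) \<and>
           (\<forall>h' \<in> sup_hom T (gorder.truncate L).
             (\<forall>x\<in>carrier X. \<forall>y\<in>carrier Y. h' (\<tau> x y) = f x y) \<longrightarrow>
              (\<forall>t\<in>carrier T. h' t = h t))"
    using T unfolding tensor_product_wrt_def by (elim conjE allE impE) assumption+
  then show ?thesis unfolding sup_hom_truncate by blast
qed

lemma tensor_unique:
  assumes T: "tensor_product_wrt TYPE('l) Q X Y T \<tau>"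
    and L: "sup_lattice (L :: ('l, 'z) gorder_scheme)"
    and h: "h1 \<in> sup_hom T L" "h2 \<in> sup_hom T L"
    and eq: "\<And>x y. x \<in> carrier X \<Longrightarrow> y \<in> carrier Y \<Longrightarrow> h1 (\<tau> x y) = h2 (\<tau> x y)"
    and t: "t \<in> carrier T"
  shows "h1 t = h2 t"
proof -
  have L': "sup_lattice (gorder.truncate L)"
    by (rule sup_lattice.sup_lattice_cong[OF L]) simp_all
  have "\<tau> \<in> balanced_map Q X Y T"
    using T unfolding tensor_product_wrt_def by simp
  then have f: "(\<lambda>x y. h2 (\<tau> x y)) \<in> balanced_map Q X Y (gorder.truncate L)"
    using balanced_map_comp[OF _ h(2)] by simp
  have "\<exists>h \<in> sup_hom T (gorder.truncate L).
          (\<forall>x\<in>carrier X. \<forall>y\<in>carrier Y. h (\<tau> x y) = h2 (\<tau> x y)) \<and>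
           (\<forall>h' \<in> sup_hom T (gorder.truncate L).
             (\<forall>x\<in>carrier X. \<forall>y\<in>carrier Y. h' (\<tau> x y) = h2 (\<tau> x y)) \<longrightarrow>
              (\<forall>t\<in>carrier T. h' t = h t))"
    using T L' f unfolding tensor_product_wrt_def by (elim conjE allE impE) assumption+
  then obtain h where u: "\<forall>h' \<in> sup_hom T L.
      (\<forall>x\<in>carrier X. \<forall>y\<in>carrier Y. h' (\<tau> x y) = h2 (\<tau> x y)) \<longrightarrow> (\<forall>t\<in>carrier T. h' t = h t)"
    unfolding sup_hom_truncate by blast
  have "h1 t = h t"
    by (rule u[rule_format, OF h(1) _ t]) (rule eq)
  moreover have "h2 t = h t"
    by (rule u[rule_format, OF h(2) _ t]) (rule refl)
  ultimately show ?thesis by simp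
qed

theorem tensor_product_any_type:
  fixes X :: "('q, 'a) qmodule" and Y :: "('q, 'b) qmodule" and T :: "('t, 'z) gorder_scheme"
  assumes "tensor_product Q X Y T \<tau>"
  shows "tensor_product_wrt TYPE('l) Q X Y T \<tau>"
proof -
  have T1: "tensor_product_wrt TYPE(('a \<times> 'b) set) Q X Y T \<tau>"
    and T2: "tensor_product_wrt TYPE('t) Q X Y T \<tau>"
    using assms by (auto simp: tensor_product_def)
  have X: "right_module Q X" and Y: "left_module Q Y" and T: "sup_lattice T"
    and \<tau>: "\<tau> \<in> balanced_map Q X Y T"
    using T1 unfolding tensor_product_wrt_def by auto
  interpret tensor_setting Q X Y
    by (intro tensor_setting.intro X Y)
  define W where "W = tensor_lattice Q X Y (\<lambda>_ :: unit. id)"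
  have Wt: "tensor_product_wrt TYPE('t) Q X Y W tens" and Wl: "tensor_product_wrt TYPE('l) Q X Y W tens"
    unfolding W_def by (rule tensor_lattice_tensor_product)+
  have W: "sup_lattice W"
    unfolding W_def by (rule tensor_sup_lattice)
  have tens: "tens \<in> balanced_map Q X Y W"
    unfolding W_def by (rule tens_balanced)
  obtain a where a: "a \<in> sup_hom T W" "\<forall>x\<in>carrier X. \<forall>y\<in>carrier Y. a (\<tau> x y) = tens x y"
    using tensor_lift[OF T1 W tens] by blast
  obtain b where b: "b \<in> sup_hom W T" "\<forall>x\<in>carrier X. \<forall>y\<in>carrier Y. b (tens x y) = \<tau> x y"
    using tensor_lift[OF Wt T \<tau>] by blast
  have ba: "b (a t) = t" if "t \<in> carrier T" for t
    by (rule tensor_unique[OF T2 T sup_hom_comp[OF a(1) b(1)] sup_hom_id _ that])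
      (simp add: a(2) b(2))
  show ?thesis
    unfolding tensor_product_wrt_def
  proof (intro conjI allI impI X Y T \<tau>)
    fix L :: "'l gorder" and f
    assume L: "sup_lattice L" and f: "f \<in> balanced_map Q X Y L"
    obtain h where h: "h \<in> sup_hom W L" "\<forall>x\<in>carrier X. \<forall>y\<in>carrier Y. h (tens x y) = f x y"
      using tensor_lift[OF Wl L f] by blast
    show "\<exists>h\<in>sup_hom T L. (\<forall>x\<in>carrier X. \<forall>y\<in>carrier Y. h (\<tau> x y) = f x y) \<and>
        (\<forall>h'\<in>sup_hom T L. (\<forall>x\<in>carrier X. \<forall>y\<in>carrier Y. h' (\<tau> x y) = f x y) \<longrightarrow>
          (\<forall>t\<in>carrier T. h' t = h t))"
    proof (intro bexI[OF _ sup_hom_comp[OF a(1) h(1)]] conjI ballI impI)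
      fix h' t assume h': "h' \<in> sup_hom T L" and t: "t \<in> carrier T"
        and eq: "\<forall>x\<in>carrier X. \<forall>y\<in>carrier Y. h' (\<tau> x y) = f x y"
      have "h' (b (a t)) = h (a t)"
        by (rule tensor_unique[OF Wl L sup_hom_comp[OF b(1) h'] h(1) _ sup_hom_closed[OF a(1) t]])
          (simp add: b(2) eq h(2))
      then show "h' t = h (a t)" by (simp add: ba[OF t])
    qed (use a h in auto)
  qed
qed

theorem tensor_product_exists:
  fixes X :: "('q, 'a) qmodule" and Y :: "('q, 'b) qmodule"
  assumes "right_module Q X" "left_module Q Y"
  shows "\<exists>(T :: ('a \<times> 'b) set gorder) \<tau>. tensor_product Q X Y T \<tau>"
proof -
  interpret tensor_setting Q X Y
    by (intro tensor_setting.intro assms)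
  let ?T = "tensor_lattice Q X Y (\<lambda>_ :: unit. id)"
  have "sup_lattice (gorder.truncate ?T)"
    by (rule sup_lattice.sup_lattice_cong[OF tensor_sup_lattice[where \<alpha> = "\<lambda>_ :: unit. id"]]) simp_all
  then have "tensor_product_wrt TYPE(('a \<times> 'b) set) Q X Y (gorder.truncate ?T) tens"
    using tensor_lattice_tensor_product[where \<alpha> = "\<lambda>_ :: unit. id" and 'l = "('a \<times> 'b) set"]
    by (simp add: tensor_product_wrt_def)
  then show ?thesis unfolding tensor_product_def by blast
qed

subsection \<open>Existence of the extension of scalars\<close>

lemma subquantale_quantale:
  fixes R :: "'r quantale"
  assumes "quantale R" "subquantale Q R"
  shows "quantale (R\<lparr>carrier := Q\<rparr>)"
    and "A \<subseteq> Q \<Longrightarrow> \<Squnion>\<^bsub>R\<lparr>carrier := Q\<rparr>\<^esub>A = \<Squnion>\<^bsub>R\<^esub>A"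
proof -
  interpret quantale R by (rule assms)
  interpret Q: subquantale Q R by (rule assms)
  have le: "\<Squnion>\<^bsub>R\<^esub>A \<sqsubseteq>\<^bsub>R\<^esub> z \<longleftrightarrow> (\<forall>a\<in>A. a \<sqsubseteq>\<^bsub>R\<^esub> z)" if "A \<subseteq> Q" "z \<in> Q" for A z
    using that Q.subset by (intro Sup_le_iff) auto
  have lat: "sup_lattice (R\<lparr>carrier := Q\<rparr>)"
  proof (rule sup_latticeI)
    fix A assume "A \<subseteq> carrier (R\<lparr>carrier := Q\<rparr>)"
    then show "\<exists>s\<in>carrier (R\<lparr>carrier := Q\<rparr>). \<forall>z\<in>carrier (R\<lparr>carrier := Q\<rparr>).
        s \<sqsubseteq>\<^bsub>R\<lparr>carrier := Q\<rparr>\<^esub> z \<longleftrightarrow> (\<forall>a\<in>A. a \<sqsubseteq>\<^bsub>R\<lparr>carrier := Q\<rparr>\<^esub> z)"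
      using le Q.Sup_mem by (intro bexI[of _ "\<Squnion>\<^bsub>R\<^esub>A"]) auto
  next
    fix x y assume "x \<in> carrier (R\<lparr>carrier := Q\<rparr>)" "y \<in> carrier (R\<lparr>carrier := Q\<rparr>)"
      "x \<sqsubseteq>\<^bsub>R\<lparr>carrier := Q\<rparr>\<^esub> y" "y \<sqsubseteq>\<^bsub>R\<lparr>carrier := Q\<rparr>\<^esub> x"
    then show "x = y" using Q.subset antisym[of x y] by auto
  next
    fix x y z assume "x \<in> carrier (R\<lparr>carrier := Q\<rparr>)" "y \<in> carrier (R\<lparr>carrier := Q\<rparr>)"
      "z \<in> carrier (R\<lparr>carrier := Q\<rparr>)" "x \<sqsubseteq>\<^bsub>R\<lparr>carrier := Q\<rparr>\<^esub> y" "y \<sqsubseteq>\<^bsub>R\<lparr>carrier := Q\<rparr>\<^esub> z"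
    then show "x \<sqsubseteq>\<^bsub>R\<lparr>carrier := Q\<rparr>\<^esub> z" using Q.subset le_trans[of x y z] by auto
  qed (use Q.subset in \<open>auto simp: eq_is_equal\<close>)
  show Sup: "\<Squnion>\<^bsub>R\<lparr>carrier := Q\<rparr>\<^esub>A = \<Squnion>\<^bsub>R\<^esub>A" if "A \<subseteq> Q" for A
    by (rule sup_lattice.Sup_eqI[OF lat]) (use that le Q.Sup_mem in auto)
  show "quantale (R\<lparr>carrier := Q\<rparr>)"
  proof (intro quantale.intro lat quantale_axioms.intro)
    fix x A assume x: "x \<in> carrier (R\<lparr>carrier := Q\<rparr>)" and A: "A \<subseteq> carrier (R\<lparr>carrier := Q\<rparr>)"
    have img: "(\<lambda>y. x \<cdot>\<^bsub>R\<^esub> y) ` A \<subseteq> Q" "(\<lambda>y. y \<cdot>\<^bsub>R\<^esub> x) ` A \<subseteq> Q"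
      using x A Q.mult_mem by auto
    have x': "x \<in> carrier R" and A': "A \<subseteq> carrier R"
      using x A Q.subset by auto
    show "x \<cdot>\<^bsub>R\<lparr>carrier := Q\<rparr>\<^esub> (\<Squnion>\<^bsub>R\<lparr>carrier := Q\<rparr>\<^esub>A) =
        \<Squnion>\<^bsub>R\<lparr>carrier := Q\<rparr>\<^esub>((\<lambda>y. x \<cdot>\<^bsub>R\<lparr>carrier := Q\<rparr>\<^esub> y) ` A)"
      using A by (simp add: Sup img mult_Sup_right[OF x' A'])
    show "(\<Squnion>\<^bsub>R\<lparr>carrier := Q\<rparr>\<^esub>A) \<cdot>\<^bsub>R\<lparr>carrier := Q\<rparr>\<^esub> x =
        \<Squnion>\<^bsub>R\<lparr>carrier := Q\<rparr>\<^esub>((\<lambda>y. y \<cdot>\<^bsub>R\<lparr>carrier := Q\<rparr>\<^esub> x) ` A)"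
      using A by (simp add: Sup img mult_Sup_left[OF x' A'])
  next
    fix x y z assume "x \<in> carrier (R\<lparr>carrier := Q\<rparr>)" "y \<in> carrier (R\<lparr>carrier := Q\<rparr>)"
      "z \<in> carrier (R\<lparr>carrier := Q\<rparr>)"
    then show "(x \<cdot>\<^bsub>R\<lparr>carrier := Q\<rparr>\<^esub> y) \<cdot>\<^bsub>R\<lparr>carrier := Q\<rparr>\<^esub> z =
        x \<cdot>\<^bsub>R\<lparr>carrier := Q\<rparr>\<^esub> (y \<cdot>\<^bsub>R\<lparr>carrier := Q\<rparr>\<^esub> z)"
      using Q.subset mult_assoc[of x y z] by auto
  next
    fix x assume "x \<in> carrier (R\<lparr>carrier := Q\<rparr>)"
    then have "x \<in> carrier R" using Q.subset by auto
    then show "qone (R\<lparr>carrier := Q\<rparr>) \<cdot>\<^bsub>R\<lparr>carrier := Q\<rparr>\<^esub> x = x"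
      and "x \<cdot>\<^bsub>R\<lparr>carrier := Q\<rparr>\<^esub> qone (R\<lparr>carrier := Q\<rparr>) = x" by simp_all
  qed (simp_all add: Q.mult_mem Q.one_mem)
qed

lemma right_regular_module:
  fixes R :: "'r quantale"
  assumes "quantale R" "subquantale Q R"
  shows "right_module (R\<lparr>carrier := Q\<rparr>) (right_regular R)"
proof -
  interpret quantale R by (rule assms)
  interpret Q: subquantale Q R by (rule assms)
  show ?thesis
  proof (intro right_module.intro right_module_axioms.intro subquantale_quantale(1)[OF assms]
      sup_lattice_cong)
    fix B x assume "B \<subseteq> carrier (R\<lparr>carrier := Q\<rparr>)" "x \<in> carrier (right_regular R)"
    then have "B \<subseteq> Q" "B \<subseteq> carrier R" "x \<in> carrier R" using Q.subset by auto
    then show "(\<Squnion>\<^bsub>R\<lparr>carrier := Q\<rparr>\<^esub>B) \<star>\<^bsub>right_regular R\<^esub> x =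
        \<Squnion>\<^bsub>right_regular R\<^esub>((\<lambda>q. q \<star>\<^bsub>right_regular R\<^esub> x) ` B)"
      by (simp add: subquantale_quantale(2)[OF assms] mult_Sup_right)
  qed (use Q.subset in \<open>auto simp: mult_assoc mult_Sup_left subset_iff\<close>)
qed

theorem scalar_extension_exists:
  fixes R :: "'r quantale" and M :: "('r, 'm) qmodule"
  assumes R: "quantale R" and Q: "subquantale Q R" and M: "left_module (R\<lparr>carrier := Q\<rparr>) M"
  shows "\<exists>(T :: ('r, ('r \<times> 'm) set) qmodule) \<tau>. scalar_extension R Q M T \<tau>"
proof -
  let ?Q = "R\<lparr>carrier := Q\<rparr>" and ?X = "right_regular R"
  interpret R: quantale R by (rule R)
  interpret Q: subquantale Q R by (rule Q)
  interpret tensor_setting ?Q ?X M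
    by (intro tensor_setting.intro right_regular_module R Q M)
  define \<alpha> where "\<alpha> r C = cl {(r \<cdot>\<^bsub>R\<^esub> s, m) | s m. (s, m) \<in> C}" for r C
  let ?T = "tensor_lattice ?Q ?X M \<alpha>"
  define K where "K r Z = {(s, m) \<in> carrier R \<times> carrier M. (r \<cdot>\<^bsub>R\<^esub> s, m) \<in> Z}" for r Z
  have satK: "sat (K r Z)" if r: "r \<in> carrier R" and Z: "sat Z" for r Z
  proof (rule saturatedI)
    fix A y assume A: "A \<subseteq> carrier ?X" and y: "y \<in> carrier M"
    have A': "A \<subseteq> carrier R" "(\<lambda>s. r \<cdot>\<^bsub>R\<^esub> s) ` A \<subseteq> carrier ?X"
      using A r by auto
    show "(\<Squnion>\<^bsub>?X\<^esub>A, y) \<in> K r Z \<longleftrightarrow> (\<forall>x\<in>A. (x, y) \<in> K r Z)"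
      using saturatedD(2)[OF Z A'(2) y] y A'(1) by (auto simp: K_def R.mult_Sup_right[OF r A'(1)])
  next
    fix x B assume x: "x \<in> carrier ?X" and B: "B \<subseteq> carrier M"
    have "r \<cdot>\<^bsub>R\<^esub> x \<in> carrier ?X" using x r by simp
    then show "(x, \<Squnion>\<^bsub>M\<^esub>B) \<in> K r Z \<longleftrightarrow> (\<forall>y\<in>B. (x, y) \<in> K r Z)"
      using saturatedD(3)[OF Z _ B] x B Y.Sup_closed[OF B] by (auto simp: K_def)
  next
    fix q x y assume q: "q \<in> carrier ?Q" and x: "x \<in> carrier ?X" and y: "y \<in> carrier M"
    have q': "q \<in> carrier R" using q Q.subset by auto
    have rx: "r \<cdot>\<^bsub>R\<^esub> x \<in> carrier ?X" using x r by simp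
    show "(q \<star>\<^bsub>?X\<^esub> x, y) \<in> K r Z \<longleftrightarrow> (x, q \<star>\<^bsub>M\<^esub> y) \<in> K r Z"
      using saturatedD(4)[OF Z q rx y] x y q' r Y.act_closed[OF q y]
      by (simp add: K_def R.mult_assoc)
  qed (auto simp: K_def)
  have dom: "C \<subseteq> carrier R \<times> carrier M" if "sat C" for C
    using saturatedD(1)[OF that] by simp
  have sat\<alpha>: "sat (\<alpha> r C)" if "r \<in> carrier R" "sat C" for r C
    unfolding \<alpha>_def by (rule sat_cl) (use that dom in auto)
  have le: "\<alpha> r C \<subseteq> Z \<longleftrightarrow> C \<subseteq> K r Z" if "sat C" "sat Z" for r C Z
    unfolding \<alpha>_def cl_le[OF that(2)] using dom[OF that(1)] by (auto simp: K_def)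
  have mod: "left_module R ?T"
  proof (intro left_module.intro R tensor_sup_lattice left_module_axioms.intro)
    fix p q C assume pq: "p \<in> carrier R" "q \<in> carrier R" and "C \<in> carrier ?T"
    then have C: "sat C" by simp
    have "\<alpha> (p \<cdot>\<^bsub>R\<^esub> q) C = \<alpha> p (\<alpha> q C)"
    proof (rule eq_by_sat)
      fix Z assume Z: "sat Z"
      have "K (p \<cdot>\<^bsub>R\<^esub> q) Z = K q (K p Z)"
        using pq by (auto simp: K_def R.mult_assoc)
      then show "\<alpha> (p \<cdot>\<^bsub>R\<^esub> q) C \<subseteq> Z \<longleftrightarrow> \<alpha> p (\<alpha> q C) \<subseteq> Z"
        by (simp add: le C Z pq sat\<alpha> satK)
    qed (simp_all add: sat\<alpha> pq C)
    then show "(p \<cdot>\<^bsub>R\<^esub> q) \<star>\<^bsub>?T\<^esub> C = p \<star>\<^bsub>?T\<^esub> (q \<star>\<^bsub>?T\<^esub> C)" by simp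
  next
    fix C assume "C \<in> carrier ?T"
    then have C: "sat C" by simp
    have "\<alpha> (qone R) C = C"
    proof (rule eq_by_sat)
      fix Z assume Z: "sat Z"
      have "K (qone R) Z = Z"
        using dom[OF Z] by (auto simp: K_def)
      then show "\<alpha> (qone R) C \<subseteq> Z \<longleftrightarrow> C \<subseteq> Z"
        by (simp add: le C Z)
    qed (simp_all add: sat\<alpha> C)
    then show "qone R \<star>\<^bsub>?T\<^esub> C = C" by simp
  next
    fix r \<A> assume r: "r \<in> carrier R" and "\<A> \<subseteq> carrier ?T"
    then have \<A>: "\<And>C. C \<in> \<A> \<Longrightarrow> sat C" by auto
    have S: "sat (cl (\<Union>\<A>))" by (rule sat_cl[OF Union_le[OF \<A>]])
    have "\<Squnion>\<^bsub>?T\<^esub>(\<alpha> r ` \<A>) = \<alpha> r (cl (\<Union>\<A>))"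
    proof (rule tensor_SupI)
      fix Z assume Z: "sat Z"
      show "\<alpha> r (cl (\<Union>\<A>)) \<subseteq> Z \<longleftrightarrow> (\<forall>C\<in>\<alpha> r ` \<A>. C \<subseteq> Z)"
        by (simp add: le[OF S Z] cl_le[OF satK[OF r Z]] le[OF \<A> Z] Sup_le_iff)
    qed (use sat\<alpha> r \<A> S in auto)
    then show "r \<star>\<^bsub>?T\<^esub> (\<Squnion>\<^bsub>?T\<^esub>\<A>) = \<Squnion>\<^bsub>?T\<^esub>((\<lambda>x. r \<star>\<^bsub>?T\<^esub> x) ` \<A>)"
      by (simp add: tensor_Sup[OF \<A>])
  next
    fix B C assume B: "B \<subseteq> carrier R" and "C \<in> carrier ?T"
    then have C: "sat C" by simp
    have BR: "\<Squnion>\<^bsub>R\<^esub>B \<in> carrier R" using B by simp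
    have "\<Squnion>\<^bsub>?T\<^esub>((\<lambda>r. \<alpha> r C) ` B) = \<alpha> (\<Squnion>\<^bsub>R\<^esub>B) C"
    proof (rule tensor_SupI)
      fix Z assume Z: "sat Z"
      have sm: "((\<Squnion>\<^bsub>R\<^esub>B) \<cdot>\<^bsub>R\<^esub> s, m) \<in> Z \<longleftrightarrow> (\<forall>b\<in>B. (b \<cdot>\<^bsub>R\<^esub> s, m) \<in> Z)"
        if "(s, m) \<in> C" for s m
      proof -
        have s: "s \<in> carrier R" and m: "m \<in> carrier M"
          using dom[OF C] that by auto
        have "(\<lambda>b. b \<cdot>\<^bsub>R\<^esub> s) ` B \<subseteq> carrier ?X" using B s by auto
        then show ?thesis
          using saturatedD(2)[OF Z _ m] by (simp add: R.mult_Sup_left[OF s B])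
      qed
      have "C \<subseteq> K r Z \<longleftrightarrow> (\<forall>s m. (s, m) \<in> C \<longrightarrow> (r \<cdot>\<^bsub>R\<^esub> s, m) \<in> Z)" for r
        using dom[OF C] by (auto simp: K_def)
      then have "C \<subseteq> K (\<Squnion>\<^bsub>R\<^esub>B) Z \<longleftrightarrow> (\<forall>b\<in>B. C \<subseteq> K b Z)"
        using sm by auto
      then show "\<alpha> (\<Squnion>\<^bsub>R\<^esub>B) C \<subseteq> Z \<longleftrightarrow> (\<forall>D\<in>(\<lambda>r. \<alpha> r C) ` B. D \<subseteq> Z)"
        by (simp add: le C Z)
    qed (use sat\<alpha> B BR C in auto)
    then show "(\<Squnion>\<^bsub>R\<^esub>B) \<star>\<^bsub>?T\<^esub> C = \<Squnion>\<^bsub>?T\<^esub>((\<lambda>q. q \<star>\<^bsub>?T\<^esub> C) ` B)" by simp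
  qed (simp add: sat\<alpha>)
  have formula: "r \<star>\<^bsub>?T\<^esub> (\<Squnion>\<^bsub>?T\<^esub>{tens s m | s m. (s, m) \<in> S}) = \<Squnion>\<^bsub>?T\<^esub>{tens (r \<cdot>\<^bsub>R\<^esub> s) m | s m. (s, m) \<in> S}"
    if r: "r \<in> carrier R" and S: "S \<subseteq> carrier R \<times> carrier M" for r S
  proof -
    have S': "S \<subseteq> carrier ?X \<times> carrier M" using S by simp
    have "\<Squnion>\<^bsub>?T\<^esub>{tens (r \<cdot>\<^bsub>R\<^esub> s) m | s m. (s, m) \<in> S} = \<alpha> r (cl S)"
    proof (rule tensor_SupI)
      fix C assume "C \<in> {tens (r \<cdot>\<^bsub>R\<^esub> s) m | s m. (s, m) \<in> S}"
      then obtain s m where "C = tens (r \<cdot>\<^bsub>R\<^esub> s) m" "(s, m) \<in> S" by auto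
      then show "sat C" using S r by (auto intro!: sat_tens)
    next
      fix Z assume Z: "sat Z"
      have "\<alpha> r (cl S) \<subseteq> Z \<longleftrightarrow> S \<subseteq> K r Z"
        unfolding le[OF sat_cl[OF S'] Z] by (rule cl_le[OF satK[OF r Z]])
      also have "\<dots> \<longleftrightarrow> (\<forall>(s, m)\<in>S. tens (r \<cdot>\<^bsub>R\<^esub> s) m \<subseteq> Z)"
        unfolding tens_le[OF Z] using S by (auto simp: K_def)
      also have "\<dots> \<longleftrightarrow> (\<forall>C\<in>{tens (r \<cdot>\<^bsub>R\<^esub> s) m | s m. (s, m) \<in> S}. C \<subseteq> Z)"
        by blast
      finally show "\<alpha> r (cl S) \<subseteq> Z \<longleftrightarrow> (\<forall>C\<in>{tens (r \<cdot>\<^bsub>R\<^esub> s) m | s m. (s, m) \<in> S}. C \<subseteq> Z)" .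
    qed (rule sat\<alpha>[OF r sat_cl[OF S']])
    then show ?thesis by (simp add: tensor_Sup_tens[OF S'])
  qed
  have "scalar_extension R Q M ?T tens"
    unfolding scalar_extension_def tensor_product_def
    by (intro conjI tensor_lattice_tensor_product mod ballI allI impI formula)
  then show ?thesis by blast
qed

end

theory Submission
  imports Defs
begin

text \<open>Write \<open>\<phi> m = 1 \<otimes> m\<close>.  Homomorphisms of \<open>R\<close>-modules out of \<open>R \<otimes> M\<close> correspond, by
  composition with \<open>\<phi>\<close>, to homomorphisms of \<open>Q\<close>-modules out of \<open>M\<close>.  Hence extension of
  scalars preserves coproducts, generators and (by restricting the scalars of the test modules)
  the lifting property.  Each summand of a coproduct is a retract of it, with retraction
  \<open>\<pi>\<close> and section \<open>\<iota>\<close>, say.  Its extension of scalars can therefore be realised inside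
  \<open>R \<otimes> M\<close>, namely as the image of the endomorphism that sends \<open>\<phi> m\<close> to \<open>\<phi> (\<iota> (\<pi> m))\<close>.\<close>

section \<open>Substructures and restriction of scalars\<close>

text \<open>A join formed in \<open>L\<close> already lies in \<open>W\<close>, so it is also the
  least upper bound among the members of \<open>W\<close>. Used for images of endomorphisms.\<close>

lemma (in sup_lattice)
  assumes W: "W \<subseteq> carrier L" and Sup: "\<And>A. A \<subseteq> W \<Longrightarrow> \<Squnion>A \<in> W"
  shows sub_sup_lattice: "sup_lattice (L\<lparr>carrier := W\<rparr>)"
    and sub_Sup: "A \<subseteq> W \<Longrightarrow> \<Squnion>\<^bsub>L\<lparr>carrier := W\<rparr>\<^esub>A = \<Squnion>A"
proof -
  have le: "\<Squnion>A \<sqsubseteq> z \<longleftrightarrow> (\<forall>a\<in>A. a \<sqsubseteq> z)" if "A \<subseteq> W" "z \<in> W" for A z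
    using that W by (intro Sup_le_iff) auto
  show lat: "sup_lattice (L\<lparr>carrier := W\<rparr>)"
  proof (rule sup_latticeI)
    fix A assume "A \<subseteq> carrier (L\<lparr>carrier := W\<rparr>)"
    then show "\<exists>s\<in>carrier (L\<lparr>carrier := W\<rparr>). \<forall>z\<in>carrier (L\<lparr>carrier := W\<rparr>).
        s \<sqsubseteq>\<^bsub>L\<lparr>carrier := W\<rparr>\<^esub> z \<longleftrightarrow> (\<forall>a\<in>A. a \<sqsubseteq>\<^bsub>L\<lparr>carrier := W\<rparr>\<^esub> z)"
      using le Sup by (intro bexI[of _ "\<Squnion>A"]) auto
  next
    fix x y assume "x \<in> carrier (L\<lparr>carrier := W\<rparr>)" "y \<in> carrier (L\<lparr>carrier := W\<rparr>)"
      "x \<sqsubseteq>\<^bsub>L\<lparr>carrier := W\<rparr>\<^esub> y" "y \<sqsubseteq>\<^bsub>L\<lparr>carrier := W\<rparr>\<^esub> x"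
    then show "x = y" using W antisym[of x y] by auto
  next
    fix x y z assume "x \<in> carrier (L\<lparr>carrier := W\<rparr>)" "y \<in> carrier (L\<lparr>carrier := W\<rparr>)"
      "z \<in> carrier (L\<lparr>carrier := W\<rparr>)" "x \<sqsubseteq>\<^bsub>L\<lparr>carrier := W\<rparr>\<^esub> y" "y \<sqsubseteq>\<^bsub>L\<lparr>carrier := W\<rparr>\<^esub> z"
    then show "x \<sqsubseteq>\<^bsub>L\<lparr>carrier := W\<rparr>\<^esub> z" using W le_trans[of x y z] by auto
  qed (use W in \<open>auto simp: eq_is_equal\<close>)
  show "\<Squnion>\<^bsub>L\<lparr>carrier := W\<rparr>\<^esub>A = \<Squnion>A" if "A \<subseteq> W"
    by (rule sup_lattice.Sup_eqI[OF lat]) (use that le Sup in auto)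
qed

text \<open>Only joins of scalars need care: they are formed in the subquantale, whose closure under
  joins makes them agree with those of \<open>R\<close>.\<close>

lemma left_module_restrict_scalars:
  fixes R :: "'r quantale" and N :: "('r, 'n) qmodule"
  assumes R: "quantale R" and Q: "subquantale Q R" and N: "left_module R N"
  shows "left_module (R\<lparr>carrier := Q\<rparr>) N"
proof -
  interpret N: left_module R N by (rule N)
  have sub: "q \<in> Q \<Longrightarrow> q \<in> carrier R" for q
    using subquantale.subset[OF Q] by blast
  show ?thesis
  proof (intro left_module.intro left_module_axioms.intro subquantale_quantale(1)[OF R Q]
      N.sup_lattice_axioms)
    fix B x assume "B \<subseteq> carrier (R\<lparr>carrier := Q\<rparr>)" and x: "x \<in> carrier N"
    then have B: "B \<subseteq> Q" and BR: "B \<subseteq> carrier R"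
      using sub by auto
    show "(\<Squnion>\<^bsub>R\<lparr>carrier := Q\<rparr>\<^esub>B) \<star>\<^bsub>N\<^esub> x = \<Squnion>\<^bsub>N\<^esub>((\<lambda>q. q \<star>\<^bsub>N\<^esub> x) ` B)"
      using N.act_Sup_left[OF BR x] by (simp add: subquantale_quantale(2)[OF R Q B])
  qed (simp_all add: sub N.act_closed N.act_mult N.act_one N.act_Sup_right)
qed

lemma qmod_hom_restrict_scalars:
  assumes "subquantale Q R" "f \<in> qmod_hom R M N"
  shows "f \<in> qmod_hom (R\<lparr>carrier := Q\<rparr>) M N"
  using assms subquantale.subset[OF assms(1)] by (auto simp: qmod_hom_def)

section \<open>Retractions onto summands and projectivity of coproducts\<close>

text \<open>Supplies the off-diagonal components in \<open>coproduct_retraction\<close>.\<close>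

lemma zero_qmod_hom:
  assumes N: "left_module Q N"
  shows "(\<lambda>_. \<Squnion>\<^bsub>N\<^esub>{}) \<in> qmod_hom Q M N"
proof -
  interpret N: left_module Q N by (rule N)
  show ?thesis
  proof (rule qmod_homI)
    fix A assume "A \<subseteq> carrier M"
    \<comment> \<open>For empty \<open>A\<close> the right-hand side is the same empty join;
      otherwise the image is a singleton.\<close>
    show "\<Squnion>\<^bsub>N\<^esub>{} = \<Squnion>\<^bsub>N\<^esub>((\<lambda>_. \<Squnion>\<^bsub>N\<^esub>{}) ` A)"
      by (cases "A = {}") (simp_all add: image_constant_conv)
  next
    fix q assume "q \<in> carrier Q"
    then show "\<Squnion>\<^bsub>N\<^esub>{} = q \<star>\<^bsub>N\<^esub> \<Squnion>\<^bsub>N\<^esub>{}"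
      using N.act_Sup_right[of q "{}"] by simp
  qed simp
qed

text \<open>The universal property is applied to a Kronecker delta: the identity on
  \<open>M i\<close> and the bottom map on every other summand.\<close>

lemma coproduct_retraction:
  assumes C: "coproduct Q I M C \<iota>" and i: "i \<in> I"
  obtains \<pi> where "\<pi> \<in> qmod_hom Q C (M i)" "\<And>x. x \<in> carrier (M i) \<Longrightarrow> \<pi> (\<iota> i x) = x"
proof -
  have Mi: "left_module Q (M i)"
    using C i unfolding coproduct_def coproduct_wrt_def by blast
  have "(if j = i then \<lambda>x. x else (\<lambda>_. \<Squnion>\<^bsub>M i\<^esub>{})) \<in> qmod_hom Q (M j) (M i)" for j
    using qmod_hom_id zero_qmod_hom[OF Mi] by auto
  from coproduct_lift[OF coproduct_any_type[OF C] Mi this] that i show thesis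
    by fastforce
qed

text \<open>Lifts chosen on the summands glue to a map \<open>h\<close> on \<open>C\<close>; then
  \<open>g \<circ> h\<close> and \<open>f\<close> agree on every summand, hence everywhere. The test
  types in \<open>projective\<close> depend on the element type, so \<open>C\<close> and the
  \<open>M i\<close> share \<open>'m\<close> and face the same lifting problems.\<close>

theorem coproduct_projective:
  fixes M :: "'i \<Rightarrow> ('q, 'm) qmodule" and C :: "('q, 'm) qmodule"
  assumes C: "coproduct Q I M C \<iota>" and proj: "\<And>i. i \<in> I \<Longrightarrow> projective Q (M i)"
  shows "projective Q C"
  unfolding projective_def projective_wrt_def
proof (intro allI impI)
  fix N :: "('q, 'm \<Rightarrow> 'q) qmodule" and P :: "('q, 'm) qmodule" and g f
  assume N: "left_module Q N" and P: "left_module Q P" and g: "g \<in> qmod_hom Q N P"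
    and surj: "g ` carrier N = carrier P" and f: "f \<in> qmod_hom Q C P"
  have \<iota>: "\<iota> i \<in> qmod_hom Q (M i) C" if "i \<in> I" for i
    using C that unfolding coproduct_def coproduct_wrt_def by blast
  have "\<exists>k\<in>qmod_hom Q (M i) N. \<forall>x\<in>carrier (M i). g (k x) = f (\<iota> i x)" if "i \<in> I" for i
    using proj[OF that, unfolded projective_def projective_wrt_def, rule_format,
        OF N P g surj qmod_hom_comp[OF \<iota>[OF that] f]] .
  then obtain k where k: "\<And>i. i \<in> I \<Longrightarrow> k i \<in> qmod_hom Q (M i) N"
      "\<And>i x. i \<in> I \<Longrightarrow> x \<in> carrier (M i) \<Longrightarrow> g (k i x) = f (\<iota> i x)"
    by metis
  obtain h where h: "h \<in> qmod_hom Q C N" "\<And>i x. i \<in> I \<Longrightarrow> x \<in> carrier (M i) \<Longrightarrow> h (\<iota> i x) = k i x"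
    using coproduct_lift[OF coproduct_any_type[OF C] N k(1)] by blast
  have "g (h c) = f c" if c: "c \<in> carrier C" for c
    by (rule coproduct_unique[OF coproduct_any_type[OF C] P qmod_hom_comp[OF h(1) g] f _ c])
      (simp add: h(2) k(2))
  then show "\<exists>h\<in>qmod_hom Q C N. \<forall>x\<in>carrier C. g (h x) = f x"
    using h(1) by blast
qed

section \<open>Images of module endomorphisms\<close>

text \<open>Since \<open>e\<close> commutes with joins and scalars, a join or multiple of images is
  the image of a join or multiple of preimages. So \<open>e\<close> factors through its image as a
  surjection followed by an inclusion.\<close>

lemma hom_image_module:
  assumes T: "left_module R T" and e: "e \<in> qmod_hom R T T"
  shows "left_module R (T\<lparr>carrier := e ` carrier T\<rparr>)"
    and "e \<in> qmod_hom R T (T\<lparr>carrier := e ` carrier T\<rparr>)"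
    and "(\<lambda>x. x) \<in> qmod_hom R (T\<lparr>carrier := e ` carrier T\<rparr>) T"
proof -
  let ?W = "e ` carrier T"
  let ?N = "T\<lparr>carrier := ?W\<rparr>"
  interpret T: left_module R T by (rule T)
  have W: "?W \<subseteq> carrier T"
    using qmod_hom_closed[OF e] by blast
  have SupW: "\<Squnion>\<^bsub>T\<^esub>A \<in> ?W" if A: "A \<subseteq> ?W" for A
  proof -
    obtain B where B: "B \<subseteq> carrier T" "A = e ` B"
      using A by (rule subset_imageE)
    then show ?thesis
      using qmod_hom_Sup[OF e B(1)] by (intro image_eqI[of _ _ "\<Squnion>\<^bsub>T\<^esub>B"]) simp_all
  qed
  have lat: "sup_lattice ?N"
    by (rule T.sub_sup_lattice[OF W]) (rule SupW)
  have Sup: "\<Squnion>\<^bsub>?N\<^esub>A = \<Squnion>\<^bsub>T\<^esub>A" if "A \<subseteq> ?W" for A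
    by (rule T.sub_Sup[OF W _ that]) (rule SupW)
  have actW: "r \<star>\<^bsub>T\<^esub> x \<in> ?W" if r: "r \<in> carrier R" and x: "x \<in> ?W" for r x
  proof -
    obtain y where y: "y \<in> carrier T" "x = e y" using x by blast
    then show ?thesis
      using qmod_hom_act[OF e r y(1)] T.act_closed[OF r y(1)]
      by (intro image_eqI[of _ _ "r \<star>\<^bsub>T\<^esub> y"]) simp_all
  qed
  show "left_module R ?N"
  proof (intro left_module.intro left_module_axioms.intro T.quantale_axioms lat)
    fix q A assume q: "q \<in> carrier R" and "A \<subseteq> carrier ?N"
    then have A: "A \<subseteq> ?W" and qA: "(\<lambda>x. q \<star>\<^bsub>T\<^esub> x) ` A \<subseteq> ?W"
      using actW by auto
    show "q \<star>\<^bsub>?N\<^esub> (\<Squnion>\<^bsub>?N\<^esub>A) = \<Squnion>\<^bsub>?N\<^esub>((\<lambda>x. q \<star>\<^bsub>?N\<^esub> x) ` A)"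
      using T.act_Sup_right[OF q, of A] A W by (simp add: Sup[OF A] Sup[OF qA])
  next
    fix B x assume B: "B \<subseteq> carrier R" and x: "x \<in> carrier ?N"
    then have Bx: "(\<lambda>q. q \<star>\<^bsub>T\<^esub> x) ` B \<subseteq> ?W"
      using actW by auto
    show "(\<Squnion>\<^bsub>R\<^esub>B) \<star>\<^bsub>?N\<^esub> x = \<Squnion>\<^bsub>?N\<^esub>((\<lambda>q. q \<star>\<^bsub>?N\<^esub> x) ` B)"
      using T.act_Sup_left[OF B, of x] x W by (auto simp: Sup[OF Bx])
  next
    fix q x assume "q \<in> carrier R" "x \<in> carrier ?N"
    then show "q \<star>\<^bsub>?N\<^esub> x \<in> carrier ?N" using actW by simp
  next
    fix p q x assume "p \<in> carrier R" "q \<in> carrier R" "x \<in> carrier ?N"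
    then show "(p \<cdot>\<^bsub>R\<^esub> q) \<star>\<^bsub>?N\<^esub> x = p \<star>\<^bsub>?N\<^esub> (q \<star>\<^bsub>?N\<^esub> x)"
      using T.act_mult W by auto
  next
    fix x assume "x \<in> carrier ?N"
    then show "qone R \<star>\<^bsub>?N\<^esub> x = x" using T.act_one W by auto
  qed
  show "e \<in> qmod_hom R T ?N"
  proof (rule qmod_homI)
    fix A assume A: "A \<subseteq> carrier T"
    then have "e ` A \<subseteq> ?W" by blast
    then show "e (\<Squnion>\<^bsub>T\<^esub>A) = \<Squnion>\<^bsub>?N\<^esub>(e ` A)"
      by (simp add: Sup qmod_hom_Sup[OF e A])
  qed (simp_all add: qmod_hom_act[OF e])
  show "(\<lambda>x. x) \<in> qmod_hom R ?N T"
    using W by (intro qmod_homI) (auto simp: Sup)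
qed

section \<open>Universal property of extension of scalars\<close>

text \<open>\<open>T\<close> with \<open>\<tau>\<close> is an arbitrary realisation of the tensor
  product, so only its universal property and the formula for the action are available.\<close>

locale extension_of_scalars =
  fixes R :: "'r quantale" and Q :: "'r set" and M :: "('r, 'm) qmodule"
    and T :: "('r, 't) qmodule" and \<tau> :: "'r \<Rightarrow> 'm \<Rightarrow> 't"
  assumes quantale: "quantale R" and subquantale: "subquantale Q R"
    and extension: "scalar_extension R Q M T \<tau>"
begin

abbreviation "Q' \<equiv> R\<lparr>carrier := Q\<rparr>"

text \<open>The unit of the adjunction between extension and restriction of scalars;
  \<open>extend\<close> and \<open>extend_unique\<close> express its universality.\<close>

definition \<phi> :: "'m \<Rightarrow> 't" where "\<phi> m = \<tau> (qone R) m"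

sublocale T: left_module R T
  using extension by (simp add: scalar_extension_def)

sublocale M: left_module Q' M
  using extension by (simp add: scalar_extension_def tensor_product_def tensor_product_wrt_def)

sublocale S: subquantale Q R
  by (rule subquantale)

lemma tensor: "tensor_product Q' (right_regular R) M T \<tau>"
  using extension by (simp add: scalar_extension_def)

lemma balanced: "\<tau> \<in> balanced_map Q' (right_regular R) M T"
  using tensor by (simp add: tensor_product_def tensor_product_wrt_def)

lemma tau_closed: "r \<in> carrier R \<Longrightarrow> m \<in> carrier M \<Longrightarrow> \<tau> r m \<in> carrier T"
  using balanced_mapD(4)[OF balanced] by simp

lemma phi_closed: "m \<in> carrier M \<Longrightarrow> \<phi> m \<in> carrier T"
  by (simp add: \<phi>_def tau_closed)

lemma act_Sup_tau:
  assumes "r \<in> carrier R" "S \<subseteq> carrier R \<times> carrier M"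
  shows "r \<star>\<^bsub>T\<^esub> (\<Squnion>\<^bsub>T\<^esub>{\<tau> s m | s m. (s, m) \<in> S}) = \<Squnion>\<^bsub>T\<^esub>{\<tau> (r \<cdot>\<^bsub>R\<^esub> s) m | s m. (s, m) \<in> S}"
  using extension assms by (simp add: scalar_extension_def)

lemma act_tau:
  assumes "r \<in> carrier R" "s \<in> carrier R" "m \<in> carrier M"
  shows "r \<star>\<^bsub>T\<^esub> \<tau> s m = \<tau> (r \<cdot>\<^bsub>R\<^esub> s) m"
  using act_Sup_tau[of r "{(s, m)}"] assms by (simp add: tau_closed)

lemma tau_eq: "r \<in> carrier R \<Longrightarrow> m \<in> carrier M \<Longrightarrow> \<tau> r m = r \<star>\<^bsub>T\<^esub> \<phi> m"
  by (simp add: \<phi>_def act_tau)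

text \<open>Scalars move across the tensor sign:
  \<open>1 \<otimes> q m = q \<otimes> m = q (1 \<otimes> m)\<close>.\<close>

lemma phi_hom: "\<phi> \<in> qmod_hom Q' M T"
proof (rule qmod_homI)
  fix A assume "A \<subseteq> carrier M"
  then show "\<phi> (\<Squnion>\<^bsub>M\<^esub>A) = \<Squnion>\<^bsub>T\<^esub>(\<phi> ` A)"
    using sup_hom_Sup[OF balanced_mapD(2)[OF balanced], of "qone R"] by (simp add: \<phi>_def[abs_def])
next
  fix q x assume q: "q \<in> carrier Q'" and x: "x \<in> carrier M"
  then have qR: "q \<in> carrier R" using S.subset by auto
  have "\<tau> (qone R) (q \<star>\<^bsub>M\<^esub> x) = \<tau> q x"
    using balanced_mapD(3)[OF balanced q _ x, of "qone R"] qR by simp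
  then show "\<phi> (q \<star>\<^bsub>M\<^esub> x) = q \<star>\<^bsub>T\<^esub> \<phi> x"
    using tau_eq[OF qR x] by (simp add: \<phi>_def)
qed (rule phi_closed)

lemma tau_generates:
  assumes t: "t \<in> carrier T"
  obtains S where "S \<subseteq> carrier R \<times> carrier M" "t = \<Squnion>\<^bsub>T\<^esub>{\<tau> s m | s m. (s, m) \<in> S}"
proof -
  text \<open>The lower sets of \<open>t\<close> and of the join \<open>w\<close> of the tensors below \<open>t\<close> are sup-homomorphisms
    from \<open>T\<close> to the opposite of the two-element lattice.  They agree on tensors, so \<open>t \<le> w\<close>.\<close>
  define L :: "bool gorder" where "L = \<lparr>carrier = UNIV, eq = (=), le = (\<lambda>x y. y \<longrightarrow> x)\<rparr>"
  have L: "sup_lattice L"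
    unfolding L_def by (rule sup_latticeI) (auto intro: exI[of _ "Ball _ id"])
  have SupL: "\<Squnion>\<^bsub>L\<^esub>A \<longleftrightarrow> (\<forall>a\<in>A. a)" for A
  proof -
    have "\<Squnion>\<^bsub>L\<^esub>A = (\<forall>a\<in>A. a)"
      by (rule sup_lattice.Sup_eqI[OF L]) (auto simp: L_def)
    then show ?thesis by simp
  qed
  have hom: "(\<lambda>x. x \<sqsubseteq>\<^bsub>T\<^esub> u) \<in> sup_hom T L" if "u \<in> carrier T" for u
  proof (rule sup_homI)
    show "(\<Squnion>\<^bsub>T\<^esub>A \<sqsubseteq>\<^bsub>T\<^esub> u) = \<Squnion>\<^bsub>L\<^esub>((\<lambda>x. x \<sqsubseteq>\<^bsub>T\<^esub> u) ` A)" if A: "A \<subseteq> carrier T" for A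
      using T.Sup_le_iff[OF A \<open>u \<in> carrier T\<close>] by (simp add: SupL)
  qed (simp add: L_def)
  define S where "S = {(s, m) \<in> carrier R \<times> carrier M. \<tau> s m \<sqsubseteq>\<^bsub>T\<^esub> t}"
  define w where "w = \<Squnion>\<^bsub>T\<^esub>{\<tau> s m | s m. (s, m) \<in> S}"
  have sub: "{\<tau> s m | s m. (s, m) \<in> S} \<subseteq> carrier T"
    using tau_closed by (auto simp: S_def)
  then have w: "w \<in> carrier T" unfolding w_def by (rule T.Sup_closed)
  have wt: "w \<sqsubseteq>\<^bsub>T\<^esub> t"
    unfolding w_def T.Sup_le_iff[OF sub t] by (auto simp: S_def)
  have "(t \<sqsubseteq>\<^bsub>T\<^esub> t) = (t \<sqsubseteq>\<^bsub>T\<^esub> w)"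
  proof (rule tensor_unique[OF tensor_product_any_type[OF tensor] L hom[OF t] hom[OF w] _ t])
    fix s m assume s: "s \<in> carrier (right_regular R)" and m: "m \<in> carrier M"
    then have sm: "\<tau> s m \<in> carrier T" by (simp add: tau_closed)
    show "(\<tau> s m \<sqsubseteq>\<^bsub>T\<^esub> t) = (\<tau> s m \<sqsubseteq>\<^bsub>T\<^esub> w)"
    proof
      assume "\<tau> s m \<sqsubseteq>\<^bsub>T\<^esub> t"
      then have "\<tau> s m \<in> {\<tau> s m | s m. (s, m) \<in> S}" using s m by (auto simp: S_def)
      then show "\<tau> s m \<sqsubseteq>\<^bsub>T\<^esub> w" unfolding w_def by (rule T.Sup_upper[OF sub])
    next
      assume "\<tau> s m \<sqsubseteq>\<^bsub>T\<^esub> w"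
      then show "\<tau> s m \<sqsubseteq>\<^bsub>T\<^esub> t" using wt sm w t by (rule T.le_trans)
    qed
  qed
  then have "t = w"
    using T.antisym[OF _ wt t w] t by simp
  moreover have "S \<subseteq> carrier R \<times> carrier M"
    by (auto simp: S_def)
  ultimately show thesis
    using that unfolding w_def by blast
qed

text \<open>As \<open>\<tau> r m\<close> is the multiple of \<open>\<phi> m\<close> by
  \<open>r\<close>, linear maps that agree on every \<open>\<phi> m\<close> agree on all tensors,
  and uniqueness for the tensor product applies.\<close>

lemma extend_unique:
  assumes N: "left_module R N" and h: "h1 \<in> qmod_hom R T N" "h2 \<in> qmod_hom R T N"
    and eq: "\<And>m. m \<in> carrier M \<Longrightarrow> h1 (\<phi> m) = h2 (\<phi> m)" and t: "t \<in> carrier T"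
  shows "h1 t = h2 t"
proof (rule tensor_unique[OF tensor_product_any_type[OF tensor] left_module.axioms(2)[OF N]
      h[THEN qmod_hom_sup_hom] _ t])
  fix r m assume "r \<in> carrier (right_regular R)" "m \<in> carrier M"
  then show "h1 (\<tau> r m) = h2 (\<tau> r m)"
    by (simp add: tau_eq qmod_hom_act[OF h(1)] qmod_hom_act[OF h(2)] phi_closed eq)
qed

text \<open>The map sending \<open>r\<close> and \<open>m\<close> to the multiple of
  \<open>f m\<close> by \<open>r\<close> is balanced because \<open>f\<close> is
  \<open>Q'\<close>-linear. The tensor product then yields only a join-preserving \<open>h\<close>;
  its \<open>R\<close>-linearity is derived from generation by tensors and the action
  formula.\<close>

lemma extend:
  assumes N: "left_module R N" and f: "f \<in> qmod_hom Q' M N"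
  obtains h where "h \<in> qmod_hom R T N" "\<And>m. m \<in> carrier M \<Longrightarrow> h (\<phi> m) = f m"
proof -
  interpret N: left_module R N by (rule N)
  note fc = qmod_hom_closed[OF f]
  have "(\<lambda>r m. r \<star>\<^bsub>N\<^esub> f m) \<in> balanced_map Q' (right_regular R) M N"
    unfolding balanced_map_def
  proof (intro CollectI conjI ballI sup_homI)
    fix y A assume y: "y \<in> carrier M" and A: "A \<subseteq> carrier (right_regular R)"
    then show "(\<Squnion>\<^bsub>right_regular R\<^esub>A) \<star>\<^bsub>N\<^esub> f y = \<Squnion>\<^bsub>N\<^esub>((\<lambda>x. x \<star>\<^bsub>N\<^esub> f y) ` A)"
      using N.act_Sup_left[of A "f y"] fc by simp
  next
    fix x A assume x: "x \<in> carrier (right_regular R)" and A: "A \<subseteq> carrier M"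
    have "f ` A \<subseteq> carrier N" using A fc by blast
    then show "x \<star>\<^bsub>N\<^esub> f (\<Squnion>\<^bsub>M\<^esub>A) = \<Squnion>\<^bsub>N\<^esub>((\<lambda>m. x \<star>\<^bsub>N\<^esub> f m) ` A)"
      using x by (simp add: qmod_hom_Sup[OF f A] N.act_Sup_right image_image)
  next
    fix q x y assume q: "q \<in> carrier Q'" and x: "x \<in> carrier (right_regular R)"
      and y: "y \<in> carrier M"
    \<comment> \<open>In \<open>right_regular R\<close> the scalar \<open>q\<close> multiplies
      \<open>x\<close> on the right, so both sides are \<open>x\<close> acting on \<open>q\<close>
      acting on \<open>f y\<close>.\<close>
    then show "(q \<star>\<^bsub>right_regular R\<^esub> x) \<star>\<^bsub>N\<^esub> f y = x \<star>\<^bsub>N\<^esub> f (q \<star>\<^bsub>M\<^esub> y)"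
      using S.subset by (auto simp: qmod_hom_act[OF f q y] fc N.act_mult)
  qed (simp_all add: fc N.act_closed)
  then obtain h where h: "h \<in> sup_hom T N"
      and h': "\<And>r m. r \<in> carrier R \<Longrightarrow> m \<in> carrier M \<Longrightarrow> h (\<tau> r m) = r \<star>\<^bsub>N\<^esub> f m"
    using tensor_lift[OF tensor_product_any_type[OF tensor] N.sup_lattice_axioms] by fastforce
  \<comment> \<open>Writing \<open>t\<close> as a join of tensors reduces linearity to associativity
    of the action: \<open>(r s) (f m) = r (s (f m))\<close>.\<close>
  have h_act: "h (r \<star>\<^bsub>T\<^esub> t) = r \<star>\<^bsub>N\<^esub> h t" if r: "r \<in> carrier R" and t: "t \<in> carrier T" for r t
  proof -
    obtain S where S: "S \<subseteq> carrier R \<times> carrier M" and tS: "t = \<Squnion>\<^bsub>T\<^esub>{\<tau> s m | s m. (s, m) \<in> S}"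
      using tau_generates[OF t] .
    have img: "{F s m | s m. (s, m) \<in> S} = (\<lambda>(s, m). F s m) ` S" for F :: "'r \<Rightarrow> 'm \<Rightarrow> 'z"
      by auto
    have "r \<star>\<^bsub>T\<^esub> t = \<Squnion>\<^bsub>T\<^esub>((\<lambda>(s, m). \<tau> (r \<cdot>\<^bsub>R\<^esub> s) m) ` S)"
      unfolding tS act_Sup_tau[OF r S] by (simp only: img)
    then have "h (r \<star>\<^bsub>T\<^esub> t) = h (\<Squnion>\<^bsub>T\<^esub>((\<lambda>(s, m). \<tau> (r \<cdot>\<^bsub>R\<^esub> s) m) ` S))"
      by simp
    also have "\<dots> = \<Squnion>\<^bsub>N\<^esub>(h ` (\<lambda>(s, m). \<tau> (r \<cdot>\<^bsub>R\<^esub> s) m) ` S)"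
      by (rule sup_hom_Sup[OF h]) (use S r tau_closed in auto)
    also have "h ` (\<lambda>(s, m). \<tau> (r \<cdot>\<^bsub>R\<^esub> s) m) ` S = (\<lambda>x. r \<star>\<^bsub>N\<^esub> x) ` h ` (\<lambda>(s, m). \<tau> s m) ` S"
      unfolding image_image using S r
      by (intro image_cong) (auto simp: h' fc N.act_mult)
    also have "\<Squnion>\<^bsub>N\<^esub>\<dots> = r \<star>\<^bsub>N\<^esub> \<Squnion>\<^bsub>N\<^esub>(h ` (\<lambda>(s, m). \<tau> s m) ` S)"
      by (rule N.act_Sup_right[symmetric, OF r]) (use S tau_closed sup_hom_closed[OF h] in auto)
    also have "\<Squnion>\<^bsub>N\<^esub>(h ` (\<lambda>(s, m). \<tau> s m) ` S) = h t"
      unfolding tS img by (rule sup_hom_Sup[OF h, symmetric]) (use S tau_closed in auto)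
    finally show ?thesis .
  qed
  show thesis
  proof (rule that)
    show "h \<in> qmod_hom R T N"
      using h h_act by (simp add: qmod_hom_def)
    show "h (\<phi> m) = f m" if "m \<in> carrier M" for m
      using that by (simp add: \<phi>_def h' fc N.act_one)
  qed
qed

section \<open>Cyclicity and projectivity of extended retracts\<close>

text \<open>The image of \<open>e\<close> plays the role of the extension of scalars of
  \<open>M'\<close>. If \<open>v\<close> generates \<open>M'\<close>, then
  \<open>\<phi> (\<iota> v)\<close> generates the image. For projectivity, a lifting problem over
  \<open>R\<close> is pulled back along \<open>\<phi> \<circ> \<iota>\<close> to one over
  \<open>Q'\<close>, solved on \<open>M'\<close>, and the solution composed with
  \<open>\<pi>\<close> is extended to \<open>T\<close>.\<close>

lemma retract_extension:
  fixes M' :: "('r, 'n) qmodule"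
  assumes M': "left_module Q' M'"
    and \<iota>: "\<iota> \<in> qmod_hom Q' M' M" and \<pi>: "\<pi> \<in> qmod_hom Q' M M'"
    and \<pi>\<iota>: "\<And>x. x \<in> carrier M' \<Longrightarrow> \<pi> (\<iota> x) = x"
    and e: "e \<in> qmod_hom R T T" and e\<phi>: "\<And>m. m \<in> carrier M \<Longrightarrow> e (\<phi> m) = \<phi> (\<iota> (\<pi> m))"
  shows retract_extension_cyclic:
      "cyclic_module Q' M' \<Longrightarrow> cyclic_module R (T\<lparr>carrier := e ` carrier T\<rparr>)"
    and retract_extension_projective:
      "projective Q' M' \<Longrightarrow> projective R (T\<lparr>carrier := e ` carrier T\<rparr>)"
proof -
  let ?N = "T\<lparr>carrier := e ` carrier T\<rparr>"
  note eN = hom_image_module(2)[OF T.left_module_axioms e]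
  \<comment> \<open>\<open>e\<close> fixes \<open>\<phi> (\<iota> x)\<close> because
    \<open>\<pi>\<close> undoes \<open>\<iota>\<close>.\<close>
  have \<phi>N: "\<phi> (\<iota> x) \<in> e ` carrier T" if x: "x \<in> carrier M'" for x
    using e\<phi>[OF qmod_hom_closed[OF \<iota> x]] phi_closed[OF qmod_hom_closed[OF \<iota> x]]
    by (intro image_eqI[of _ _ "\<phi> (\<iota> x)"]) (simp_all add: \<pi>\<iota> x)
  show "cyclic_module R ?N" if cyc: "cyclic_module Q' M'"
  proof -
    obtain v where v: "v \<in> carrier M'" and gen: "carrier M' = {q \<star>\<^bsub>M'\<^esub> v | q. q \<in> carrier Q'}"
      using cyc unfolding cyclic_module_def by blast
    let ?w = "\<phi> (\<iota> v)"
    have w: "?w \<in> carrier T"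
      by (rule phi_closed[OF qmod_hom_closed[OF \<iota> v]])
    have "\<exists>r\<in>carrier R. e t = r \<star>\<^bsub>T\<^esub> ?w" if t: "t \<in> carrier T" for t
    proof -
      obtain S where S: "S \<subseteq> carrier R \<times> carrier M" and tS: "t = \<Squnion>\<^bsub>T\<^esub>{\<tau> s m | s m. (s, m) \<in> S}"
        using tau_generates[OF t] .
      have "\<exists>r. r \<in> carrier R \<and> e (\<tau> s m) = r \<star>\<^bsub>T\<^esub> ?w" if "(s, m) \<in> S" for s m
      proof -
        have s: "s \<in> carrier R" and m: "m \<in> carrier M" using S that by auto
        obtain q where q: "q \<in> carrier Q'" "\<pi> m = q \<star>\<^bsub>M'\<^esub> v"
          using gen qmod_hom_closed[OF \<pi> m] by blast
        then have qR: "q \<in> carrier R" using S.subset by auto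
        have "e (\<tau> s m) = s \<star>\<^bsub>T\<^esub> \<phi> (\<iota> (\<pi> m))"
          by (simp add: tau_eq s m qmod_hom_act[OF e] phi_closed e\<phi>)
        also have "\<phi> (\<iota> (\<pi> m)) = q \<star>\<^bsub>T\<^esub> ?w"
          using qmod_hom_act[OF qmod_hom_comp[OF \<iota> phi_hom] q(1) v] q(2) by simp
        also have "s \<star>\<^bsub>T\<^esub> q \<star>\<^bsub>T\<^esub> ?w = (s \<cdot>\<^bsub>R\<^esub> q) \<star>\<^bsub>T\<^esub> ?w"
          using T.act_mult[OF s qR w] by simp
        finally show ?thesis using s qR by blast
      qed
      \<comment> \<open>One scalar is chosen for each tensor in the join. Their join is the scalar
        for \<open>e t\<close>, since the action preserves joins of scalars.\<close>
      then obtain \<rho> where \<rho>: "\<And>s m. (s, m) \<in> S \<Longrightarrow> \<rho> s m \<in> carrier R"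
          "\<And>s m. (s, m) \<in> S \<Longrightarrow> e (\<tau> s m) = \<rho> s m \<star>\<^bsub>T\<^esub> ?w"
        by metis
      have img: "{\<tau> s m | s m. (s, m) \<in> S} = (\<lambda>(s, m). \<tau> s m) ` S" by auto
      have \<rho>S: "(\<lambda>(s, m). \<rho> s m) ` S \<subseteq> carrier R" using \<rho>(1) by auto
      have "e t = \<Squnion>\<^bsub>T\<^esub>(e ` (\<lambda>(s, m). \<tau> s m) ` S)"
        unfolding tS img by (rule qmod_hom_Sup[OF e]) (use S tau_closed in auto)
      also have "e ` (\<lambda>(s, m). \<tau> s m) ` S = (\<lambda>r. r \<star>\<^bsub>T\<^esub> ?w) ` (\<lambda>(s, m). \<rho> s m) ` S"
        unfolding image_image by (intro image_cong) (auto simp: \<rho>(2))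
      also have "\<Squnion>\<^bsub>T\<^esub>\<dots> = (\<Squnion>\<^bsub>R\<^esub>((\<lambda>(s, m). \<rho> s m) ` S)) \<star>\<^bsub>T\<^esub> ?w"
        by (rule T.act_Sup_left[symmetric, OF \<rho>S w])
      finally show ?thesis using T.Sup_closed \<rho>S quantale.axioms(1)[OF quantale]
          sup_lattice.Sup_closed by blast
    qed
    moreover have "r \<star>\<^bsub>T\<^esub> ?w \<in> e ` carrier T" if "r \<in> carrier R" for r
      using left_module.act_closed[OF hom_image_module(1)[OF T.left_module_axioms e] that, of ?w]
        \<phi>N[OF v] by simp
    ultimately show ?thesis
      unfolding cyclic_module_def using \<phi>N[OF v] by (intro bexI[of _ ?w]) auto
  qed
  show "projective R ?N" if proj: "projective Q' M'"
    unfolding projective_def projective_wrt_def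
  proof (intro allI impI)
    fix N :: "('r, 't \<Rightarrow> 'r) qmodule" and P :: "('r, 't) qmodule" and g f
    assume N: "left_module R N" and P: "left_module R P" and g: "g \<in> qmod_hom R N P"
      and surj: "g ` carrier N = carrier P" and f: "f \<in> qmod_hom R ?N P"
    have fe: "(\<lambda>t. f (e t)) \<in> qmod_hom R T P"
      by (rule qmod_hom_comp[OF eN f])
    have "(\<lambda>x. f (e (\<phi> (\<iota> x)))) \<in> qmod_hom Q' M' P"
      by (rule qmod_hom_comp[OF qmod_hom_comp[OF \<iota> phi_hom]
            qmod_hom_restrict_scalars[OF subquantale fe]])
    \<comment> \<open>The types of \<open>N\<close> and \<open>P\<close> come from \<open>T\<close>
      rather than from \<open>M'\<close>, hence the appeal to
      \<open>projective_any_type\<close>.\<close>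
    then obtain k where k: "k \<in> qmod_hom Q' M' N"
        "\<And>x. x \<in> carrier M' \<Longrightarrow> g (k x) = f (e (\<phi> (\<iota> x)))"
      using projective_any_type[OF M' proj, unfolded projective_wrt_def, rule_format,
          OF left_module_restrict_scalars[OF quantale subquantale N]
            left_module_restrict_scalars[OF quantale subquantale P]
            qmod_hom_restrict_scalars[OF subquantale g] surj] by blast
    obtain h where h: "h \<in> qmod_hom R T N" "\<And>m. m \<in> carrier M \<Longrightarrow> h (\<phi> m) = k (\<pi> m)"
      by (rule extend[OF N qmod_hom_comp[OF \<pi> k(1)]]) blast
    have he: "(\<lambda>t. g (h (e t))) \<in> qmod_hom R T P"
      by (rule qmod_hom_comp[OF e qmod_hom_comp[OF h(1) g]])
    \<comment> \<open>Both sides are linear in \<open>t\<close>, so it suffices to take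
      \<open>t = \<phi> m\<close>, where both reduce to
      \<open>f (\<phi> (\<iota> (\<pi> m)))\<close>.\<close>
    have "g (h (e t)) = f (e t)" if t: "t \<in> carrier T" for t
    proof (rule extend_unique[OF P he fe _ t])
      fix m assume m: "m \<in> carrier M"
      note m' = qmod_hom_closed[OF \<pi> m]
      note m'' = qmod_hom_closed[OF \<iota> m']
      show "g (h (e (\<phi> m))) = f (e (\<phi> m))"
        using k(2)[OF m'] by (simp add: e\<phi> m m'' h(2) \<pi>\<iota> m')
    qed
    then show "\<exists>h\<in>qmod_hom R ?N N. \<forall>x\<in>carrier ?N. g (h x) = f x"
      using qmod_hom_comp[OF hom_image_module(3)[OF T.left_module_axioms e] h(1)]
      by (intro bexI[of _ h]) auto
  qed
qed

text \<open>The case of the trivial retract: with \<open>\<iota>\<close>, \<open>\<pi>\<close> and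
  \<open>e\<close> identities, the image is all of \<open>T\<close>.\<close>

lemma extension_cyclic_projective:
  assumes "cyclic_module Q' M" "projective Q' M"
  shows "cyclic_module R T" "projective R T"
proof -
  note r = M.left_module_axioms qmod_hom_id[of Q' M] qmod_hom_id[of Q' M] refl qmod_hom_id[of R T] refl
  show "cyclic_module R T"
    using retract_extension_cyclic[OF r assms(1)] by simp
  show "projective R T"
    using retract_extension_projective[OF r assms(2)] by simp
qed

section \<open>Extension of scalars of coproducts\<close>

text \<open>A family \<open>f i\<close> on the images becomes
  \<open>f i \<circ> e i \<circ> \<phi> \<circ> \<iota> i\<close> on the \<open>Ms i\<close>, is
  glued over \<open>Q'\<close> to a map on \<open>M\<close>, and is extended to \<open>T\<close>.
  Uniqueness descends the same way, from \<open>T\<close> to \<open>M\<close> to the summands. The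
  test type is left free because \<open>coproduct\<close> asks for two of them.\<close>

lemma coproduct_extension:
  assumes C: "coproduct Q' I Ms M \<iota>"
    and e: "\<And>i. i \<in> I \<Longrightarrow> e i \<in> qmod_hom R T T"
    and \<pi>: "\<And>i. i \<in> I \<Longrightarrow> \<pi> i \<in> qmod_hom Q' M (Ms i)"
      "\<And>i x. i \<in> I \<Longrightarrow> x \<in> carrier (Ms i) \<Longrightarrow> \<pi> i (\<iota> i x) = x"
    and e\<phi>: "\<And>i m. i \<in> I \<Longrightarrow> m \<in> carrier M \<Longrightarrow> e i (\<phi> m) = \<phi> (\<iota> i (\<pi> i m))"
  shows "coproduct_wrt TYPE('n) R I (\<lambda>i. T\<lparr>carrier := e i ` carrier T\<rparr>) T (\<lambda>_ x. x)"
proof -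
  let ?N = "\<lambda>i. T\<lparr>carrier := e i ` carrier T\<rparr>"
  note img = hom_image_module[OF T.left_module_axioms e]
  have \<iota>: "\<iota> i \<in> qmod_hom Q' (Ms i) M" if "i \<in> I" for i
    using C that unfolding coproduct_def coproduct_wrt_def by blast
  have e\<iota>: "e i (\<phi> (\<iota> i x)) = \<phi> (\<iota> i x)" if "i \<in> I" "x \<in> carrier (Ms i)" for i x
    using e\<phi>[OF that(1) qmod_hom_closed[OF \<iota>[OF that(1)] that(2)]] that by (simp add: \<pi>(2))
  have e\<iota>_mem: "\<phi> (\<iota> i x) \<in> e i ` carrier T" if "i \<in> I" "x \<in> carrier (Ms i)" for i x
    by (rule image_eqI[where x = "\<phi> (\<iota> i x)"])
      (simp_all only: e\<iota>[OF that] phi_closed[OF qmod_hom_closed[OF \<iota>[OF that(1)] that(2)]])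
  show ?thesis
    unfolding coproduct_wrt_def
  proof (intro conjI ballI allI impI)
    fix N :: "('r, 'n) qmodule" and f
    assume N: "left_module R N" and f: "\<forall>i\<in>I. f i \<in> qmod_hom R (?N i) N"
    have fe: "(\<lambda>t. f i (e i t)) \<in> qmod_hom R T N" if "i \<in> I" for i
      by (rule qmod_hom_comp[OF img(2)[OF that] bspec[OF f that]])
    note NQ = left_module_restrict_scalars[OF quantale subquantale N]
    have "(\<lambda>x. f i (e i (\<phi> (\<iota> i x)))) \<in> qmod_hom Q' (Ms i) N" if "i \<in> I" for i
      by (rule qmod_hom_comp[OF qmod_hom_comp[OF \<iota>[OF that] phi_hom]
            qmod_hom_restrict_scalars[OF subquantale fe[OF that]]])
    from coproduct_lift[OF coproduct_any_type[OF C] NQ this]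
    obtain g where g: "g \<in> qmod_hom Q' M N"
        "\<And>i x. i \<in> I \<Longrightarrow> x \<in> carrier (Ms i) \<Longrightarrow> g (\<iota> i x) = f i (e i (\<phi> (\<iota> i x)))"
      by blast
    obtain h where h: "h \<in> qmod_hom R T N" "\<And>m. m \<in> carrier M \<Longrightarrow> h (\<phi> m) = g m"
      by (rule extend[OF N g(1)]) blast
    \<comment> \<open>Every element of the image has the form \<open>e i t\<close>, so this says
      that \<open>h\<close> restricts to \<open>f i\<close>. For \<open>t = \<phi> m\<close> both
      sides reduce to \<open>f i (\<phi> (\<iota> i (\<pi> i m)))\<close>.\<close>
    have he: "h (e i t) = f i (e i t)" if i: "i \<in> I" and t: "t \<in> carrier T" for i t
    proof (rule extend_unique[OF N qmod_hom_comp[OF e[OF i] h(1)] fe[OF i] _ t])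
      fix m assume m: "m \<in> carrier M"
      note m' = qmod_hom_closed[OF \<pi>(1)[OF i] m]
      note m'' = qmod_hom_closed[OF \<iota>[OF i] m']
      show "h (e i (\<phi> m)) = f i (e i (\<phi> m))"
        using g(2)[OF i m'] by (simp add: e\<phi> i m h(2) m'' \<pi>(2)[OF i m'])
    qed
    show "\<exists>h\<in>qmod_hom R T N. (\<forall>i\<in>I. \<forall>x\<in>carrier (?N i). h x = f i x) \<and>
        (\<forall>h'\<in>qmod_hom R T N. (\<forall>i\<in>I. \<forall>x\<in>carrier (?N i). h' x = f i x) \<longrightarrow>
          (\<forall>c\<in>carrier T. h' c = h c))"
    proof (intro bexI[OF _ h(1)] conjI ballI impI)
      fix i x assume "i \<in> I" "x \<in> carrier (?N i)"
      then show "h x = f i x" using he by auto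
    next
      fix h' c assume h': "h' \<in> qmod_hom R T N" and c: "c \<in> carrier T"
        and eq: "\<forall>i\<in>I. \<forall>x\<in>carrier (?N i). h' x = f i x"
      show "h' c = h c"
      proof (rule extend_unique[OF N h' h(1) _ c])
        fix m assume m: "m \<in> carrier M"
        show "h' (\<phi> m) = h (\<phi> m)"
        proof (rule coproduct_unique[OF coproduct_any_type[OF C] NQ
              qmod_hom_comp[OF phi_hom qmod_hom_restrict_scalars[OF subquantale h']]
              qmod_hom_comp[OF phi_hom qmod_hom_restrict_scalars[OF subquantale h(1)]] _ m])
          fix i x assume i: "i \<in> I" and x: "x \<in> carrier (Ms i)"
          \<comment> \<open>The element \<open>\<phi> (\<iota> i x)\<close> lies in the image of
            \<open>e i\<close>, where the values of \<open>h'\<close> are prescribed.\<close>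
          have "h' (\<phi> (\<iota> i x)) = f i (\<phi> (\<iota> i x))"
            by (rule eq[rule_format, OF i]) (use e\<iota>_mem[OF i x] in simp)
          also have "\<dots> = h (\<phi> (\<iota> i x))"
            using he[OF i phi_closed[OF qmod_hom_closed[OF \<iota>[OF i] x]]] e\<iota>[OF i x] by simp
          finally show "h' (\<phi> (\<iota> i x)) = h (\<phi> (\<iota> i x))" .
        qed
      qed
    qed
  qed (simp_all add: img T.left_module_axioms)
qed

text \<open>The new summands are the images of the maps \<open>e i\<close> extending
  \<open>\<phi> \<circ> \<iota> i \<circ> \<pi> i\<close>, with the inclusions into \<open>T\<close>
  as injections. Each is a retract extension, so it inherits cyclicity and projectivity from
  \<open>Ms i\<close>.\<close>

lemma coproduct_extension_projective:
  fixes Ms :: "'i \<Rightarrow> ('r, 'n) qmodule"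
  assumes Ms: "\<And>i. i \<in> I \<Longrightarrow> cyclic_module Q' (Ms i)" "\<And>i. i \<in> I \<Longrightarrow> projective Q' (Ms i)"
    and C: "coproduct Q' I Ms M \<iota>"
  obtains Ns :: "'i \<Rightarrow> ('r, 't) qmodule" and \<kappa>
  where "\<And>i. i \<in> I \<Longrightarrow> cyclic_module R (Ns i)" "\<And>i. i \<in> I \<Longrightarrow> projective R (Ns i)"
    "coproduct R I Ns T \<kappa>"
proof -
  have mods: "left_module Q' (Ms i)" and \<iota>: "\<iota> i \<in> qmod_hom Q' (Ms i) M" if "i \<in> I" for i
    using C that unfolding coproduct_def coproduct_wrt_def by blast+
  have "\<exists>\<pi>. \<pi> \<in> qmod_hom Q' M (Ms i) \<and> (\<forall>x\<in>carrier (Ms i). \<pi> (\<iota> i x) = x)" if "i \<in> I" for i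
    by (rule coproduct_retraction[OF C that]) blast
  then obtain \<pi> where \<pi>: "\<And>i. i \<in> I \<Longrightarrow> \<pi> i \<in> qmod_hom Q' M (Ms i)"
      "\<And>i x. i \<in> I \<Longrightarrow> x \<in> carrier (Ms i) \<Longrightarrow> \<pi> i (\<iota> i x) = x"
    by metis
  have "\<exists>e. e \<in> qmod_hom R T T \<and> (\<forall>m\<in>carrier M. e (\<phi> m) = \<phi> (\<iota> i (\<pi> i m)))" if "i \<in> I" for i
    by (rule extend[OF T.left_module_axioms
          qmod_hom_comp[OF qmod_hom_comp[OF \<pi>(1)[OF that] \<iota>[OF that]] phi_hom]]) blast
  then obtain e where e: "\<And>i. i \<in> I \<Longrightarrow> e i \<in> qmod_hom R T T"
      "\<And>i m. i \<in> I \<Longrightarrow> m \<in> carrier M \<Longrightarrow> e i (\<phi> m) = \<phi> (\<iota> i (\<pi> i m))"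
    by metis
  show thesis
  proof (rule that)
    show "coproduct R I (\<lambda>i. T\<lparr>carrier := e i ` carrier T\<rparr>) T (\<lambda>_ x. x)"
      unfolding coproduct_def by (intro conjI coproduct_extension[OF C e(1) \<pi> e(2)])
    fix i assume i: "i \<in> I"
    note r = mods[OF i] \<iota>[OF i] \<pi>(1)[OF i] \<pi>(2)[OF i] e(1)[OF i] e(2)[OF i]
    show "cyclic_module R (T\<lparr>carrier := e i ` carrier T\<rparr>)"
      by (rule retract_extension_cyclic[OF r Ms(1)[OF i]])
    show "projective R (T\<lparr>carrier := e i ` carrier T\<rparr>)"
      by (rule retract_extension_projective[OF r Ms(2)[OF i]])
  qed
qed

end

theorem theorem4p7p13:
  fixes R :: "'r quantale" and Q :: "'r set"
    and M :: "('r, 'm) qmodule" and T :: "('r, 't) qmodule" and \<tau> :: "'r \<Rightarrow> 'm \<Rightarrow> 't"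
  assumes "quantale R"
    and "subquantale Q R"
    and "left_module (R\<lparr>carrier := Q\<rparr>) M"
    and "scalar_extension R Q M T \<tau>"
  shows "(cyclic_module (R\<lparr>carrier := Q\<rparr>) M \<and> projective (R\<lparr>carrier := Q\<rparr>) M \<longrightarrow>
            cyclic_module R T \<and> projective R T) \<and>
         (\<forall>(I :: 'i set) (Ms :: 'i \<Rightarrow> ('r, 'n) qmodule) \<iota>.
            (\<forall>i\<in>I. cyclic_module (R\<lparr>carrier := Q\<rparr>) (Ms i) \<and> projective (R\<lparr>carrier := Q\<rparr>) (Ms i)) \<and>
            coproduct (R\<lparr>carrier := Q\<rparr>) I Ms M \<iota> \<longrightarrow>
              (\<exists>(Ns :: 'i \<Rightarrow> ('r, 't) qmodule) \<kappa>.
                 (\<forall>i\<in>I. cyclic_module R (Ns i) \<and> projective R (Ns i)) \<and> coproduct R I Ns T \<kappa>) \<and>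
              projective R T)"
proof -
  interpret extension_of_scalars R Q M T \<tau>
    by (intro extension_of_scalars.intro assms)
  show ?thesis
  proof (intro conjI impI allI)
    assume "cyclic_module Q' M \<and> projective Q' M"
    then show "cyclic_module R T" "projective R T"
      using extension_cyclic_projective by blast+
  next
    fix I and Ms :: "'i \<Rightarrow> ('r, 'n) qmodule" and \<iota>
    assume "(\<forall>i\<in>I. cyclic_module Q' (Ms i) \<and> projective Q' (Ms i)) \<and> coproduct Q' I Ms M \<iota>"
    then obtain Ns :: "'i \<Rightarrow> ('r, 't) qmodule" and \<kappa>
      where Ns: "\<And>i. i \<in> I \<Longrightarrow> cyclic_module R (Ns i)" "\<And>i. i \<in> I \<Longrightarrow> projective R (Ns i)"
        "coproduct R I Ns T \<kappa>"
      using coproduct_extension_projective[of I Ms \<iota>] by metis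
    then show "\<exists>(Ns :: 'i \<Rightarrow> ('r, 't) qmodule) \<kappa>.
        (\<forall>i\<in>I. cyclic_module R (Ns i) \<and> projective R (Ns i)) \<and> coproduct R I Ns T \<kappa>"
      by blast
    \<comment> \<open>Realising the summands inside \<open>T\<close> gives them its element type, as
      \<open>coproduct_projective\<close> requires.\<close>
    show "projective R T"
      by (rule coproduct_projective[OF Ns(3) Ns(2)])
  qed
qed

end
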